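(* Let $T>0$, $I=[-T,T]$, $a,b,h\in L^1(I)$, with $a$ even, let $A(t)=\int_0^ta(r)\,dr$, $B(t)=\int_0^tb(r)\,dr$, and let $b_e$ and $B_e$ be the even parts of $b$ and $B$. Assume that one of the following conditions holds: $(C1^* )$ $b_e=k\,a$ for some $k\in\mathbb{R}$ with $|k|<1$, $(1-k^2)A(T)^2\neq(n\pi)^2$ for all $n=0,1,2,\dots$, and $\cos(\sqrt{1-k^2}\,A(T))\neq0$; $(C2^* )$ $b_e=k\,a$ for some $k\in\mathbb{R}$ with $|k|>1$, and $(1-k^2)A(T)^2\neq(n\pi)^2$ for all $n=0,1,2,\dots$; $(C3^* )$ $b_e=a$ (that is, $k=1$), and $A(T)\neq0$. Let $\overline{G_2}$ be the Green's function of the constant-coefficient problem $$y'(t)+y(-t)+k\,y(t)=f(t),\quad t\in[-|A(T)|,|A(T)|],\qquad y(A(T))=y(-A(T)),$$ and write it as $$\overline{G_2}(t,s)=\begin{cases}k_1(t,s), & t>|s|,\\ k_2(t,s), & s>|t|,\\ k_3(t,s), & -t>|s|,\\ k_4(t,s), & -s>|t|,\end{cases}$$ where $k_1,\dots,k_4$ are the explicit expressions of $\overline{G_2}$ in the four regions. Define $$G_1(t,s):=e^{B_e(s)-B_e(t)}\begin{cases}k_1(A(t),A(s)), & t>|s|,\\ k_2(A(t),A(s)), & s>|t|,\\ k_3(A(t),A(s)), & -t>|s|,\\ k_4(A(t),A(s)), & -s>|t|.\end{cases}$$ Suppose that $G_1(t,\cdot)h(\cdot)\in L^1(I)$ for every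 $t\in I$. Then the problem $$x'(t)+a(t)\,x(-t)+b(t)\,x(t)=h(t),\quad t\in I,\qquad x(-T)=x(T),$$ has a unique solution, given by $$u(t)=\int_{-T}^TG_1(t,s)h(s)\,ds.$$
   Context: The even part of a function $f$ is $f_e(t)=\frac{f(t)+f(-t)}2$. Equalities between $L^1$ functions are almost everywhere. A solution is an absolutely continuous function satisfying the equation almost everywhere together with the boundary condition. The Green's function $\overline{G_2}$ of the constant-coefficient problem is the kernel such that, for every integrable $f$, the unique solution of that problem is $y(t)=\int_{-|A(T)|}^{|A(T)|}\overline{G_2}(t,s)f(s)\,ds$. Under each of $(C1^* )$, $(C2^* )$, $(C3^* )$ this problem is uniquely solvable. When $k\neq\pm1$, $\overline{G_2}(t,s)=G(-t,s)-k\,G(t,s)+\frac{\partial G}{\partial t}(t,s)$, where $G$ is the Green's function of $y''+(1-k^2)y=0$ on $[-|A(T)|,|A(T)|]$ with $y(-|A(T)|)=y(|A(T)|)$, $y'(-|A(T)|)=y'(|A(T)|)$. In each of the four regions $\overline{G_2}$ is given by an elementary real-analytic expression (trigonometric, hyperbolic or polynomial according to the case). The functions $k_i$ denote these expressions, regarded as defined on all of $\mathbb{R}^2$, so that $k_i(A(t),A(s))$ makes sense for all $t,s\in I$. ($A$ need not be injective.)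
   Formalization: When A(T)<0 the formula for u with k_i read off on [-|A(T)|,|A(T)|] is false (e.g. T=1, a=b=-1, h=1); there the k_i are taken as the expressions written with the signed endpoint A(T), i.e. k_1,k_2,k_3,k_4 become -k_3,-k_4,-k_1,-k_2. *)

theory Defs
  imports "HOL-Analysis.Analysis"
begin

definition even_part :: "(real \<Rightarrow> real) \<Rightarrow> real \<Rightarrow> real" where
  "even_part f t = (f t + f (- t)) / 2"

(* The oriented integral of f from 0 to t: for each t, one of the two intervals is empty or {0}. *)
definition primitive :: "(real \<Rightarrow> real) \<Rightarrow> real \<Rightarrow> real" where
  "primitive f t = integral {0..t} f - integral {t..0} f"

definition abs_continuous_on :: "real \<Rightarrow> real \<Rightarrow> (real \<Rightarrow> real) \<Rightarrow> bool" where
  "abs_continuous_on c d f \<longleftrightarrow>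
     (\<forall>\<epsilon>>0. \<exists>\<delta>>0. \<forall>(n::nat) l r.
        (\<forall>i<n. c \<le> l i \<and> l i \<le> r i \<and> r i \<le> d) \<longrightarrow>
        disjoint_family_on (\<lambda>i. {l i<..<r i}) {..<n} \<longrightarrow>
        (\<Sum>i<n. r i - l i) < \<delta> \<longrightarrow>
        (\<Sum>i<n. \<bar>f (r i) - f (l i)\<bar>) < \<epsilon>)"

(* x'(t) + a(t) x(-t) + b(t) x(t) = h(t) on [-T,T], x(-T) = x(T).
   Only the values of x on [-T,T] matter. *)
definition periodic_solution ::
  "real \<Rightarrow> (real \<Rightarrow> real) \<Rightarrow> (real \<Rightarrow> real) \<Rightarrow> (real \<Rightarrow> real) \<Rightarrow> (real \<Rightarrow> real) \<Rightarrow> bool" where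
  "periodic_solution T a b h x \<longleftrightarrow>
     abs_continuous_on (- T) T x \<and>
     (AE t in lebesgue_on {- T..T}.
        \<exists>x'. (x has_real_derivative x') (at t within {- T..T}) \<and>
             x' + a t * x (- t) + b t * x t = h t) \<and>
     x (- T) = x T"

definition unique_periodic_solution ::
  "real \<Rightarrow> (real \<Rightarrow> real) \<Rightarrow> (real \<Rightarrow> real) \<Rightarrow> (real \<Rightarrow> real) \<Rightarrow> (real \<Rightarrow> real) \<Rightarrow> bool" where
  "unique_periodic_solution T a b h u \<longleftrightarrow>
     periodic_solution T a b h u \<and>
     (\<forall>x. periodic_solution T a b h x \<longrightarrow> (\<forall>t\<in>{- T..T}. x t = u t))"

(* G is a Green's function of y'(t) + y(-t) + k y(t) = f(t) on [-\<tau>,\<tau>], y(\<tau>) = y(-\<tau>).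
   For each t this determines G(t,.) up to a null set. *)
definition is_green_function :: "real \<Rightarrow> real \<Rightarrow> (real \<Rightarrow> real \<Rightarrow> real) \<Rightarrow> bool" where
  "is_green_function k \<tau> G \<longleftrightarrow>
     (\<forall>f. f absolutely_integrable_on {- \<tau>..\<tau>} \<longrightarrow>
        (\<forall>t\<in>{- \<tau>..\<tau>}. (\<lambda>s. G t s * f s) absolutely_integrable_on {- \<tau>..\<tau>}) \<and>
        unique_periodic_solution \<tau> (\<lambda>_. 1) (\<lambda>_. k) f
          (\<lambda>t. integral {- \<tau>..\<tau>} (\<lambda>s. G t s * f s)))"

definition real_analytic2 :: "(real \<Rightarrow> real \<Rightarrow> real) \<Rightarrow> bool" where
  "real_analytic2 f \<longleftrightarrow>
     (\<forall>t0 s0. \<exists>(c :: nat \<Rightarrow> nat \<Rightarrow> real). \<exists>\<rho>>0. \<forall>t s.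
        \<bar>t - t0\<bar> < \<rho> \<longrightarrow> \<bar>s - s0\<bar> < \<rho> \<longrightarrow>
        ((\<lambda>(m, n). c m n * (t - t0) ^ m * (s - s0) ^ n) has_sum f t s) UNIV)"

(* k1, ..., k4 are the expressions of the Green's function G on [-|p|,|p|] in the four regions,
   as analytic functions on the whole plane (which makes them unique).  For p > 0 the signs sgn p
   disappear and this says literally that G = k1 for t > |s|, G = k2 for s > |t|, G = k3 for
   -t > |s| and G = k4 for -s > |t|.
   For p < 0 the expressions are those written with the signed endpoint p: with
   \<omega> = sqrt (1 - k^2), for instance,
     k1(t,s) = (cos(\<omega>(p-t-s)) - k cos(\<omega>(p-t+s)) + \<omega> sin(\<omega>(p-t+s))) / (2 \<omega> sin(\<omega> p)).
   Changing the sign of p exchanges k1 with -k3 and k2 with -k4, that is, the interval from -p to p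
   and the regions are traversed in the opposite orientation. *)
definition green_expressions ::
  "real \<Rightarrow> (real \<Rightarrow> real \<Rightarrow> real) \<Rightarrow> (real \<Rightarrow> real \<Rightarrow> real) \<Rightarrow> (real \<Rightarrow> real \<Rightarrow> real) \<Rightarrow>
   (real \<Rightarrow> real \<Rightarrow> real) \<Rightarrow> (real \<Rightarrow> real \<Rightarrow> real) \<Rightarrow> bool" where
  "green_expressions p G k1 k2 k3 k4 \<longleftrightarrow>
     real_analytic2 k1 \<and> real_analytic2 k2 \<and> real_analytic2 k3 \<and> real_analytic2 k4 \<and>
     (\<forall>t\<in>{- \<bar>p\<bar>..\<bar>p\<bar>}. \<forall>s\<in>{- \<bar>p\<bar>..\<bar>p\<bar>}.
        (sgn p * t > \<bar>s\<bar> \<longrightarrow> G t s = sgn p * k1 t s) \<and>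
        (sgn p * s > \<bar>t\<bar> \<longrightarrow> G t s = sgn p * k2 t s) \<and>
        (- (sgn p * t) > \<bar>s\<bar> \<longrightarrow> G t s = sgn p * k3 t s) \<and>
        (- (sgn p * s) > \<bar>t\<bar> \<longrightarrow> G t s = sgn p * k4 t s))"

(* The value on the diagonals |t| = |s| is irrelevant: for fixed t they contain at most two s. *)
definition green1 ::
  "(real \<Rightarrow> real) \<Rightarrow> (real \<Rightarrow> real) \<Rightarrow>
   (real \<Rightarrow> real \<Rightarrow> real) \<Rightarrow> (real \<Rightarrow> real \<Rightarrow> real) \<Rightarrow>
   (real \<Rightarrow> real \<Rightarrow> real) \<Rightarrow> (real \<Rightarrow> real \<Rightarrow> real) \<Rightarrow> real \<Rightarrow> real \<Rightarrow> real" where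
  "green1 A B k1 k2 k3 k4 t s =
     exp (even_part B s - even_part B t) *
     (if t > \<bar>s\<bar> then k1 (A t) (A s)
      else if s > \<bar>t\<bar> then k2 (A t) (A s)
      else if - t > \<bar>s\<bar> then k3 (A t) (A s)
      else if - s > \<bar>t\<bar> then k4 (A t) (A s)
      else 0)"

definition cond_C1 :: "real \<Rightarrow> (real \<Rightarrow> real) \<Rightarrow> (real \<Rightarrow> real) \<Rightarrow> real \<Rightarrow> bool" where
  "cond_C1 T a b k \<longleftrightarrow>
     (AE t in lebesgue_on {- T..T}. even_part b t = k * a t) \<and> \<bar>k\<bar> < 1 \<and>
     (\<forall>n::nat. (1 - k\<^sup>2) * (primitive a T)\<^sup>2 \<noteq> (real n * pi)\<^sup>2) \<and>
     cos (sqrt (1 - k\<^sup>2) * primitive a T) \<noteq> 0"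

definition cond_C2 :: "real \<Rightarrow> (real \<Rightarrow> real) \<Rightarrow> (real \<Rightarrow> real) \<Rightarrow> real \<Rightarrow> bool" where
  "cond_C2 T a b k \<longleftrightarrow>
     (AE t in lebesgue_on {- T..T}. even_part b t = k * a t) \<and> \<bar>k\<bar> > 1 \<and>
     (\<forall>n::nat. (1 - k\<^sup>2) * (primitive a T)\<^sup>2 \<noteq> (real n * pi)\<^sup>2)"

definition cond_C3 :: "real \<Rightarrow> (real \<Rightarrow> real) \<Rightarrow> (real \<Rightarrow> real) \<Rightarrow> real \<Rightarrow> bool" where
  "cond_C3 T a b k \<longleftrightarrow>
     (AE t in lebesgue_on {- T..T}. even_part b t = a t) \<and> k = 1 \<and> primitive a T \<noteq> 0"

end

theory Submission
  imports Defs "HOL-Complex_Analysis.Cauchy_Integral_Formula"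
begin

text \<open>Multiplying by \<open>exp (even_part B)\<close> removes the odd part of \<open>b\<close>
    and leaves
  \<open>y'(t) + a(t) (y(-t) + k y(t)) = H(t)\<close>. For the even and odd parts of
      \<open>y\<close> this is a linear system
  \<open>y\<^sub>e' = (1 - k) a y\<^sub>o + H\<^sub>o\<close>, \<open>y\<^sub>o' = - (1 + k) a
      y\<^sub>e + H\<^sub>e\<close>, whose coefficients are constant in the variable
  \<open>A(t)\<close>. Hence \<open>cos\<close> and \<open>sin\<close> of \<open>sqrt (1 -
      k\<^sup>2) A(t)\<close> (hyperbolic or polynomial for \<open>k\<^sup>2 \<ge> 1\<close>) solve the
  homogeneous system, and variation of constants gives the solution as an integral with kernel
  \<open>e\<^sub>i(A(t), A(s))\<close>, with \<open>e\<^sub>i\<close> elementary and depending only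
      on \<open>k\<close>, \<open>A(T)\<close> and the region. The case \<open>a = 1\<close>,
      \<open>b = k\<close> shows
  that the \<open>e\<^sub>i\<close> form a Green's function of the constant-coefficient problem, so
      uniqueness for that problem and
  analyticity force \<open>k\<^sub>i = e\<^sub>i\<close> on the whole plane.\<close>

subsection \<open>Absolutely continuous functions\<close>

text \<open>\<open>A\<close> need be neither monotone nor injective, and on \<open>{- T..T}\<close>
  it may take values outside [-|A(T)|, |A(T)|]. So the substitution r = A(s) cannot transport
  solutions from the constant-coefficient problem. The given problem is therefore solved directly,
  and \<open>k1\<close>, ..., \<open>k4\<close> must be recognised on the whole plane, not just on
  the square where the Green's function lives. Homogeneous solutions are the multiples of cos - (1 +
  k) sin, in generalised functions of \<open>A t\<close>. Periodicity asks the odd part to vanish at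
  \<open>T\<close>. This is a linear equation for y(0) with coefficient
  \<open>2 * (1 + k) * gen_sin (1 - k\<^sup>2) (A T)\<close>: the denominator of the kernel, nonzero
  under each of the three conditions. A Green's function is known only through its integrals against
  f, for each t up to a null set of s. It is compared with the explicit kernel by testing against
  their difference. As \<open>a\<close>, \<open>b\<close>, \<open>h\<close> are merely integrable,
  equations hold almost everywhere. Two facts replace the calculus of C1 functions: an absolutely
  continuous function with derivative 0 almost everywhere is constant, and indefinite integrals are
  absolutely continuous with the expected derivative almost everywhere.\<close>

lemma AE_lebesgue_on_iff_negligible:
  fixes S :: "real set"
  assumes "S \<in> sets lebesgue"
  shows "(AE t in lebesgue_on S. P t) \<longleftrightarrow> (\<exists>N. negligible N \<and>
      (\<forall>t\<in>S - N. P t))"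
proof
  assume "AE t in lebesgue_on S. P t"
  then have "AE t in lebesgue. t \<in> S \<longrightarrow> P t"
    using assms by (simp add: AE_restrict_space_iff)
  then obtain N where "N \<in> null_sets lebesgue" "{t. \<not> (t \<in> S \<longrightarrow> P t)}
      \<subseteq> N"
    by (auto simp: eventually_ae_filter)
  then show "\<exists>N. negligible N \<and> (\<forall>t\<in>S - N. P t)"
    by (intro exI[of _ N]) (auto simp: negligible_iff_null_sets)
next
  assume "\<exists>N. negligible N \<and> (\<forall>t\<in>S - N. P t)"
  then obtain N where "N \<in> null_sets lebesgue" "{t. \<not> (t \<in> S \<longrightarrow> P t)}
      \<subseteq> N"
    by (auto simp: negligible_iff_null_sets)
  then have "AE t in lebesgue. t \<in> S \<longrightarrow> P t"
    by (auto simp: eventually_ae_filter)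
  then show "AE t in lebesgue_on S. P t"
    using assms by (simp add: AE_restrict_space_iff)
qed

lemma negligible_uminus_image:
  fixes N :: "real set"
  assumes "negligible N"
  shows "negligible (uminus ` N)"
  by (rule negligible_differentiable_image_negligible[OF _ assms])
    (auto intro!: derivative_intros)

lemma AE_lebesgue_on_reflect:
  assumes "AE t in lebesgue_on {- T..T :: real}. P t"
  shows "AE t in lebesgue_on {- T..T}. P (- t)"
proof -
  obtain N where N: "negligible N" "\<forall>t\<in>{- T..T} - N. P t"
    using assms by (auto simp: AE_lebesgue_on_iff_negligible)
  have "P (- t)" if "t \<in> {- T..T} - uminus ` N" for t
  proof -
    have "- t \<notin> N"
      using that by (metis DiffD2 image_eqI minus_minus)
    then show ?thesis
      using N(2) that by auto
  qed
  then show ?thesis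
    using negligible_uminus_image[OF N(1)] by (auto simp: AE_lebesgue_on_iff_negligible)
qed

lemma AE_lebesgue_on_interior:
  "AE t in lebesgue_on {a..b :: real}. t \<in> {a<..<b}"
  by (subst AE_lebesgue_on_iff_negligible, simp, intro exI[of _ "{a, b}"]) auto

text \<open>The definition indexes intervals by initial segments of the naturals, whereas the pieces
  of a tagged division form a finite set of pairs. Enumerating that set along a bijection bridges
  the gap.\<close>

lemma abs_continuous_on_finite_family:
  assumes "abs_continuous_on c d f" and "\<epsilon> > 0"
  shows "\<exists>\<delta>>0. \<forall>(J :: 'i set) l r. finite J \<longrightarrow>
      (\<forall>i\<in>J. c \<le> l i \<and> l i \<le> r i \<and> r i \<le> d) \<longrightarrow>
        disjoint_family_on (\<lambda>i. {l i<..<r i}) J \<longrightarrow> (\<Sum>i\<in>J. r i - l i)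
            < \<delta> \<longrightarrow>
        (\<Sum>i\<in>J. \<bar>f (r i) - f (l i)\<bar>) < \<epsilon>"
proof -
  obtain \<delta> where "\<delta> > 0" and \<delta>: "\<And>(n::nat) l r. (\<forall>i<n. c \<le> l i
      \<and> l i \<le> r i \<and> r i \<le> d) \<Longrightarrow>
        disjoint_family_on (\<lambda>i. {l i<..<r i}) {..<n} \<Longrightarrow> (\<Sum>i<n. r i - l
            i) < \<delta> \<Longrightarrow>
        (\<Sum>i<n. \<bar>f (r i) - f (l i)\<bar>) < \<epsilon>"
    using assms unfolding abs_continuous_on_def by meson
  show ?thesis
  proof (intro exI[of _ \<delta>] conjI allI impI)
    show "\<delta> > 0" by fact
    fix J :: "'i set" and l r :: "'i \<Rightarrow> real"
    assume J: "finite J" and lr: "\<forall>i\<in>J. c \<le> l i \<and> l i \<le> r i \<and> r i \<le> d"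
      and disj: "disjoint_family_on (\<lambda>i. {l i<..<r i}) J"
      and sum: "(\<Sum>i\<in>J. r i - l i) < \<delta>"
    obtain g where g: "bij_betw g {..<card J} J"
      using J ex_bij_betw_nat_finite[of J] by (auto simp: atLeast0LessThan)
    have gJ: "g i \<in> J" if "i < card J" for i
      using g that by (auto simp: bij_betw_def)
    have inj: "g i \<noteq> g j" if "i < card J" "j < card J" "i \<noteq> j" for i j
      using g that by (auto simp: bij_betw_def inj_on_def)
    have "(\<Sum>i<card J. \<bar>f (r (g i)) - f (l (g i))\<bar>) < \<epsilon>"
    proof (rule \<delta>)
      show "\<forall>i<card J. c \<le> l (g i) \<and> l (g i) \<le> r (g i) \<and> r (g i) \<le> d"
        using lr gJ by blast
      show "disjoint_family_on (\<lambda>i. {l (g i)<..<r (g i)}) {..<card J}"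
        using disj gJ inj unfolding disjoint_family_on_def by (metis lessThan_iff)
      show "(\<Sum>i<card J. r (g i) - l (g i)) < \<delta>"
        using sum sum.reindex_bij_betw[OF g, of "\<lambda>i. r i - l i"] by simp
    qed
    then show "(\<Sum>i\<in>J. \<bar>f (r i) - f (l i)\<bar>) < \<epsilon>"
      using sum.reindex_bij_betw[OF g, of "\<lambda>i. \<bar>f (r i) - f (l i)\<bar>"] by simp
  qed
qed

lemma abs_continuous_on_subinterval:
  assumes "abs_continuous_on c d f" "c \<le> c'" "d' \<le> d"
  shows "abs_continuous_on c' d' f"
  unfolding abs_continuous_on_def
proof (intro allI impI)
  fix \<epsilon> :: real
  assume "\<epsilon> > 0"
  with assms(1) obtain \<delta> where "\<delta> > 0"
    and \<delta>: "\<And>(n::nat) l r. (\<forall>i<n. c \<le> l i \<and> l i \<le> r i \<and> r i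
        \<le> d) \<Longrightarrow>
        disjoint_family_on (\<lambda>i. {l i<..<r i}) {..<n} \<Longrightarrow> (\<Sum>i<n. r i - l
            i) < \<delta> \<Longrightarrow>
        (\<Sum>i<n. \<bar>f (r i) - f (l i)\<bar>) < \<epsilon>"
    unfolding abs_continuous_on_def by meson
  show "\<exists>\<delta>>0. \<forall>(n::nat) l r. (\<forall>i<n. c' \<le> l i \<and> l i \<le> r i
      \<and> r i \<le> d') \<longrightarrow>
        disjoint_family_on (\<lambda>i. {l i<..<r i}) {..<n} \<longrightarrow> (\<Sum>i<n. r i - l
            i) < \<delta> \<longrightarrow>
        (\<Sum>i<n. \<bar>f (r i) - f (l i)\<bar>) < \<epsilon>"
  proof (intro exI[of _ \<delta>] conjI allI impI)
    fix n :: nat and l r :: "nat \<Rightarrow> real"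
    assume lr: "\<forall>i<n. c' \<le> l i \<and> l i \<le> r i \<and> r i \<le> d'"
      and disj: "disjoint_family_on (\<lambda>i. {l i<..<r i}) {..<n}"
      and sum: "(\<Sum>i<n. r i - l i) < \<delta>"
    from lr assms(2,3) have "\<forall>i<n. c \<le> l i \<and> l i \<le> r i \<and> r i \<le> d"
      by (meson order_trans)
    then show "(\<Sum>i<n. \<bar>f (r i) - f (l i)\<bar>) < \<epsilon>"
      using disj sum by (rule \<delta>)
  qed fact
qed

lemma abs_continuous_on_imp_continuous_on:
  assumes "abs_continuous_on c d f"
  shows "continuous_on {c..d} f"
  unfolding continuous_on_iff
proof (intro ballI allI impI)
  fix x \<epsilon> :: real
  assume x: "x \<in> {c..d}" and "\<epsilon> > 0"
  then obtain \<delta> where "\<delta> > 0"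
    and \<delta>: "\<And>(n::nat) l r. (\<forall>i<n. c \<le> l i \<and> l i \<le> r i \<and> r i
        \<le> d) \<Longrightarrow>
        disjoint_family_on (\<lambda>i. {l i<..<r i}) {..<n} \<Longrightarrow> (\<Sum>i<n. r i - l
            i) < \<delta> \<Longrightarrow>
        (\<Sum>i<n. \<bar>f (r i) - f (l i)\<bar>) < \<epsilon>"
    using assms unfolding abs_continuous_on_def by meson
  have "dist (f y) (f x) < \<epsilon>" if y: "y \<in> {c..d}" "dist y x < \<delta>" for y
  proof -
    have "disjoint_family_on (\<lambda>i. {min x y<..<max x y}) {..<1::nat}"
      by (auto simp: disjoint_family_on_def)
    then have "(\<Sum>i<1::nat. \<bar>f (max x y) - f (min x y)\<bar>) < \<epsilon>"
      using x y by (intro \<delta>) (auto simp: dist_real_def)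
    then show ?thesis
      by (cases "x \<le> y") (auto simp: dist_real_def min_def max_def)
  qed
  then show "\<exists>\<delta>>0. \<forall>y\<in>{c..d}. dist y x < \<delta> \<longrightarrow> dist
      (f y) (f x) < \<epsilon>"
    using \<open>\<delta> > 0\<close> by blast
qed

text \<open>Common source of the closure properties: sums, products and smooth compositions have
  increments bounded by a constant times the increments of their ingredients.\<close>

lemma abs_continuous_on_lipschitz_pair:
  assumes f: "abs_continuous_on c d f" and g: "abs_continuous_on c d g"
    and L: "L \<ge> 0" "\<And>x y. x \<in> {c..d} \<Longrightarrow> y \<in> {c..d} \<Longrightarrow>
        \<bar>u y - u x\<bar> \<le> L * (\<bar>f y - f x\<bar> + \<bar>g y - g x\<bar>)"
  shows "abs_continuous_on c d u"
  unfolding abs_continuous_on_def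
proof (intro allI impI)
  fix \<epsilon> :: real
  assume "\<epsilon> > 0"
  \<comment> \<open>\<open>L + 1\<close> instead of \<open>L\<close> allows \<open>L = 0\<close>;
    the half accounts for the two functions \<open>f\<close> and \<open>g\<close>.\<close>
  define e where "e = \<epsilon> / (L + 1) / 2"
  have e: "e > 0"
    using \<open>\<epsilon> > 0\<close> L by (simp add: e_def)
  obtain \<delta>1 where \<delta>1: "\<delta>1 > 0" "\<And>(n::nat) l r. (\<forall>i<n. c \<le> l i
      \<and> l i \<le> r i \<and> r i \<le> d) \<Longrightarrow>
        disjoint_family_on (\<lambda>i. {l i<..<r i}) {..<n} \<Longrightarrow> (\<Sum>i<n. r i - l
            i) < \<delta>1 \<Longrightarrow>
        (\<Sum>i<n. \<bar>f (r i) - f (l i)\<bar>) < e"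
    using f e unfolding abs_continuous_on_def by meson
  obtain \<delta>2 where \<delta>2: "\<delta>2 > 0" "\<And>(n::nat) l r. (\<forall>i<n. c \<le> l i
      \<and> l i \<le> r i \<and> r i \<le> d) \<Longrightarrow>
        disjoint_family_on (\<lambda>i. {l i<..<r i}) {..<n} \<Longrightarrow> (\<Sum>i<n. r i - l
            i) < \<delta>2 \<Longrightarrow>
        (\<Sum>i<n. \<bar>g (r i) - g (l i)\<bar>) < e"
    using g e unfolding abs_continuous_on_def by meson
  show "\<exists>\<delta>>0. \<forall>(n::nat) l r. (\<forall>i<n. c \<le> l i \<and> l i \<le> r i
      \<and> r i \<le> d) \<longrightarrow>
        disjoint_family_on (\<lambda>i. {l i<..<r i}) {..<n} \<longrightarrow> (\<Sum>i<n. r i - l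
            i) < \<delta> \<longrightarrow>
        (\<Sum>i<n. \<bar>u (r i) - u (l i)\<bar>) < \<epsilon>"
  proof (intro exI[of _ "min \<delta>1 \<delta>2"] conjI allI impI)
    show "min \<delta>1 \<delta>2 > 0"
      using \<delta>1 \<delta>2 by simp
    fix n :: nat and l r :: "nat \<Rightarrow> real"
    assume lr: "\<forall>i<n. c \<le> l i \<and> l i \<le> r i \<and> r i \<le> d"
      and disj: "disjoint_family_on (\<lambda>i. {l i<..<r i}) {..<n}"
      and sum: "(\<Sum>i<n. r i - l i) < min \<delta>1 \<delta>2"
    have "(\<Sum>i<n. \<bar>u (r i) - u (l i)\<bar>) \<le> (\<Sum>i<n. L * (\<bar>f (r i) - f (l
        i)\<bar> + \<bar>g (r i) - g (l i)\<bar>))"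
      using lr by (intro sum_mono L) force+
    also have "\<dots> = L * ((\<Sum>i<n. \<bar>f (r i) - f (l i)\<bar>) + (\<Sum>i<n. \<bar>g (r i)
        - g (l i)\<bar>))"
      by (simp add: sum_distrib_left sum.distrib distrib_left)
    also have "\<dots> \<le> L * (e + e)"
      using L(1) \<delta>1(2)[OF lr disj] \<delta>2(2)[OF lr disj] sum by (intro mult_left_mono) auto
    also have "\<dots> < (L + 1) * (e + e)"
      using e by (simp add: algebra_simps)
    also have "\<dots> = \<epsilon>"
      using L(1) by (simp only: e_def field_sum_of_halves times_divide_eq_right
          nonzero_mult_div_cancel_left)
    finally show "(\<Sum>i<n. \<bar>u (r i) - u (l i)\<bar>) < \<epsilon>" .
  qed
qed

lemma abs_continuous_on_const: "abs_continuous_on c d (\<lambda>_. C)"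
  by (auto simp: abs_continuous_on_def intro: exI[of _ 1])

lemma abs_continuous_on_add:
  assumes "abs_continuous_on c d f" "abs_continuous_on c d g"
  shows "abs_continuous_on c d (\<lambda>x. f x + g x)"
  using assms by (rule abs_continuous_on_lipschitz_pair[where L = 1]) auto

lemma abs_continuous_on_diff:
  assumes "abs_continuous_on c d f" "abs_continuous_on c d g"
  shows "abs_continuous_on c d (\<lambda>x. f x - g x)"
  using assms by (rule abs_continuous_on_lipschitz_pair[where L = 1]) auto

lemma abs_continuous_on_mult:
  assumes f: "abs_continuous_on c d f" and g: "abs_continuous_on c d g"
  shows "abs_continuous_on c d (\<lambda>x. f x * g x)"
proof -
  have "bounded (f ` {c..d})" "bounded (g ` {c..d})"
    using f g by (auto intro!: compact_imp_bounded compact_continuous_image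
        abs_continuous_on_imp_continuous_on)
  then obtain M1 M2 where M1: "\<And>x. x \<in> {c..d} \<Longrightarrow> \<bar>f x\<bar> \<le> M1"
      and M2: "\<And>x. x \<in> {c..d} \<Longrightarrow> \<bar>g x\<bar> \<le> M2"
    unfolding bounded_real by (metis imageI)
  \<comment> \<open>The absolute values make \<open>M\<close> nonnegative even when the interval is
    empty and \<open>M1\<close>, \<open>M2\<close> are arbitrary.\<close>
  define M where "M = \<bar>M1\<bar> + \<bar>M2\<bar>"
  show ?thesis
  proof (rule abs_continuous_on_lipschitz_pair[OF f g, of M])
    show "M \<ge> 0"
      by (simp add: M_def)
    fix x y
    assume xy: "x \<in> {c..d}" "y \<in> {c..d}"
    have "f y * g y - f x * g x = f y * (g y - g x) + g x * (f y - f x)"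
      by (simp add: algebra_simps)
    then have "\<bar>f y * g y - f x * g x\<bar> \<le> \<bar>f y\<bar> * \<bar>g y - g x\<bar> +
        \<bar>g x\<bar> * \<bar>f y - f x\<bar>"
      by (metis abs_mult abs_triangle_ineq)
    also have "\<dots> \<le> M * \<bar>g y - g x\<bar> + M * \<bar>f y - f x\<bar>"
      using M1[OF xy(2)] M2[OF xy(1)] by (intro add_mono mult_right_mono) (auto simp: M_def)
    finally show "\<bar>f y * g y - f x * g x\<bar> \<le> M * (\<bar>f y - f x\<bar> + \<bar>g y - g
        x\<bar>)"
      by (simp add: algebra_simps)
  qed
qed

lemma abs_continuous_on_compose_C1:
  assumes f: "abs_continuous_on c d f"
    and deriv: "\<And>x. (\<phi> has_real_derivative \<phi>' x) (at x)" and cont: "continuous_on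
        UNIV \<phi>'"
  shows "abs_continuous_on c d (\<lambda>x. \<phi> (f x))"
proof -
  have "bounded (f ` {c..d})"
    using f by (auto intro!: compact_imp_bounded compact_continuous_image
        abs_continuous_on_imp_continuous_on)
  then obtain M where M: "\<And>x. x \<in> {c..d} \<Longrightarrow> \<bar>f x\<bar> \<le> M"
    unfolding bounded_real by (metis imageI)
  have "bounded (\<phi>' ` {- M..M})"
    by (intro compact_imp_bounded compact_continuous_image continuous_on_subset[OF cont]) auto
  then obtain L where L: "\<And>x. x \<in> {- M..M} \<Longrightarrow> \<bar>\<phi>' x\<bar> \<le> L"
    unfolding bounded_real by (metis imageI)
  \<comment> \<open>On the compact interval containing the values of \<open>f\<close>, the
    continuous \<phi>' is bounded, so \<phi> is Lipschitz there.\<close>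
  have lip: "\<bar>\<phi> v - \<phi> u\<bar> \<le> \<bar>L\<bar> * \<bar>v - u\<bar>" if "u \<in> {-
      M..M}" "v \<in> {- M..M}" for u v
  proof -
    have "norm (\<phi> v - \<phi> u) \<le> \<bar>L\<bar> * norm (v - u)"
    proof (rule field_differentiable_bound[of "{- M..M}" \<phi> \<phi>'])
      show "norm (\<phi>' z) \<le> \<bar>L\<bar>" if "z \<in> {- M..M}" for z
        using L[OF that] by simp
    qed (use that deriv in \<open>auto intro: has_field_derivative_at_within\<close>)
    then show ?thesis
      by simp
  qed
  \<comment> \<open>The constant 0 takes the place of the second function.\<close>
  show ?thesis
  proof (rule abs_continuous_on_lipschitz_pair[OF f abs_continuous_on_const[of c d 0], of
      "\<bar>L\<bar>"])
    fix x y
    assume "x \<in> {c..d}" "y \<in> {c..d}"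
    then have "f x \<in> {- M..M}" "f y \<in> {- M..M}"
      using M by (auto simp: abs_le_iff minus_le_iff)
    then show "\<bar>\<phi> (f y) - \<phi> (f x)\<bar> \<le> \<bar>L\<bar> * (\<bar>f y - f x\<bar>
        + \<bar>0 - 0\<bar>)"
      using lip[of "f x" "f y"] by simp
  qed simp
qed

lemma abs_continuous_on_reflect:
  assumes f: "abs_continuous_on (- T) T f"
  shows "abs_continuous_on (- T) T (\<lambda>x. f (- x))"
  unfolding abs_continuous_on_def
proof (intro allI impI)
  fix \<epsilon> :: real
  assume "\<epsilon> > 0"
  then obtain \<delta> where "\<delta> > 0" and \<delta>: "\<And>(n::nat) l r. (\<forall>i<n. - T
      \<le> l i \<and> l i \<le> r i \<and> r i \<le> T) \<Longrightarrow>
        disjoint_family_on (\<lambda>i. {l i<..<r i}) {..<n} \<Longrightarrow> (\<Sum>i<n. r i - l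
            i) < \<delta> \<Longrightarrow>
        (\<Sum>i<n. \<bar>f (r i) - f (l i)\<bar>) < \<epsilon>"
    using f unfolding abs_continuous_on_def by meson
  show "\<exists>\<delta>>0. \<forall>(n::nat) l r. (\<forall>i<n. - T \<le> l i \<and> l i \<le> r
      i \<and> r i \<le> T) \<longrightarrow>
        disjoint_family_on (\<lambda>i. {l i<..<r i}) {..<n} \<longrightarrow> (\<Sum>i<n. r i - l
            i) < \<delta> \<longrightarrow>
        (\<Sum>i<n. \<bar>f (- r i) - f (- l i)\<bar>) < \<epsilon>"
  proof (intro exI[of _ \<delta>] conjI allI impI)
    show "\<delta> > 0" by fact
    fix n :: nat and l r :: "nat \<Rightarrow> real"
    assume lr: "\<forall>i<n. - T \<le> l i \<and> l i \<le> r i \<and> r i \<le> T"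
      and disj: "disjoint_family_on (\<lambda>i. {l i<..<r i}) {..<n}"
      and sum: "(\<Sum>i<n. r i - l i) < \<delta>"
    have "{- r i<..<- l i} \<inter> {- r j<..<- l j} = {}" if "{l i<..<r i} \<inter> {l j<..<r j} =
        {}" for i j
    proof -
      have "{- r i<..<- l i} = uminus ` {l i<..<r i}" for i
        by simp
      then show ?thesis
        using that by (metis image_Int image_is_empty inj_uminus)
    qed
    then have "disjoint_family_on (\<lambda>i. {- r i<..<- l i}) {..<n}"
      using disj unfolding disjoint_family_on_def by blast
    moreover have "\<forall>i<n. - T \<le> - r i \<and> - r i \<le> - l i \<and> - l i \<le> T"
      using lr by force
    ultimately have "(\<Sum>i<n. \<bar>f (- l i) - f (- r i)\<bar>) < \<epsilon>"
      using sum by (intro \<delta>) auto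
    then show "(\<Sum>i<n. \<bar>f (- r i) - f (- l i)\<bar>) < \<epsilon>"
      by (simp add: abs_minus_commute)
  qed
qed

lemmas abs_continuous_intros = abs_continuous_on_const abs_continuous_on_add
  abs_continuous_on_diff abs_continuous_on_mult abs_continuous_on_reflect

text \<open>Cousin's lemma, with the gauge given by a small open neighbourhood of the exceptional
    null set
  at its points, and by the derivative elsewhere.\<close>

lemma abs_continuous_on_ends_eq_if_deriv_zero:
  assumes f: "abs_continuous_on c d f" and "c \<le> d" and N: "negligible N"
    and deriv: "\<And>t. t \<in> {c..d} - N \<Longrightarrow> (f has_real_derivative 0) (at t within
        {c..d})"
  shows "f d = f c"
proof -
  \<comment> \<open>Pieces tagged in \<open>N\<close> lie in \<open>U\<close>, so their total length
    is below \<delta> and absolute continuity bounds their increments by \<epsilon>. Any other piece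
    contributes at most \<epsilon> times its length.\<close>
  have bound: "\<bar>f d - f c\<bar> \<le> \<epsilon> + \<epsilon> * (d - c)" if "\<epsilon> > 0"
      for \<epsilon>
  proof -
    obtain \<delta> where "\<delta> > 0"
      and \<delta>: "\<forall>(J :: (real \<times> real set) set) l r. finite J \<longrightarrow>
        (\<forall>i\<in>J. c \<le> l i \<and> l i \<le> r i \<and> r i \<le> d) \<longrightarrow>
        disjoint_family_on (\<lambda>i. {l i<..<r i}) J \<longrightarrow> (\<Sum>i\<in>J. r i - l i)
            < \<delta> \<longrightarrow>
        (\<Sum>i\<in>J. \<bar>f (r i) - f (l i)\<bar>) < \<epsilon>"
      using abs_continuous_on_finite_family[OF f \<open>\<epsilon> > 0\<close>, where 'i = "real
          \<times> real set"]
      by (elim exE conjE)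
    obtain U where U: "open U" "N \<subseteq> U" "U - N \<in> lmeasurable" "emeasure lebesgue (U -
        N) < ennreal \<delta>"
      using sets_lebesgue_outer_open[OF negligible_imp_sets[OF N] \<open>\<delta> > 0\<close>] by blast
    have U_meas: "U \<in> lmeasurable"
      using U(3) N
      by (metis Un_Diff_cancel2 U(2) fmeasurable.Un negligible_imp_measurable sup.absorb1)
    have "measure lebesgue U = measure lebesgue (U - N)"
      using N U_meas by (simp add: measure_Diff_null_set fmeasurableD negligible_iff_null_sets)
    then have U_small: "measure lebesgue U < \<delta>"
      using U(3,4) \<open>\<delta> > 0\<close> by (simp add: emeasure_eq_measure2 ennreal_less_iff)
    have "\<exists>e>0. \<forall>y\<in>{c..d}. \<bar>y - x\<bar> < e \<longrightarrow> \<bar>f y - f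
        x\<bar> \<le> \<epsilon> * \<bar>y - x\<bar>" if "x \<in> {c..d} - N" for x
      using deriv[OF that] \<open>\<epsilon> > 0\<close> unfolding has_field_derivative_def
          has_derivative_within_alt
      by auto
    then obtain e where e: "\<And>x. x \<in> {c..d} - N \<Longrightarrow> e x > 0"
      "\<And>x y. x \<in> {c..d} - N \<Longrightarrow> y \<in> {c..d} \<Longrightarrow> \<bar>y -
          x\<bar> < e x \<Longrightarrow> \<bar>f y - f x\<bar> \<le> \<epsilon> * \<bar>y - x\<bar>"
      by metis
    define \<gamma> where "\<gamma> x = (if x \<in> N then U else if x \<in> {c..d} then ball x (e
        x) else UNIV)" for x
    have "gauge \<gamma>"
      using U(1,2) e(1) by (auto simp: gauge_def \<gamma>_def)
    then obtain p where p: "p tagged_division_of {c..d}" "\<gamma> fine p"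
      using fine_division_exists_real by blast
    have fin: "finite p"
      using p(1) by blast
    define l r where "l i = Inf (snd i)" and "r i = Sup (snd i)" for i :: "real \<times> real set"
    have piece: "snd i = {l i..r i}" "fst i \<in> {l i..r i}" "l i \<le> r i" "c \<le> l i" "r i
        \<le> d"
      "{l i..r i} \<subseteq> \<gamma> (fst i)" if ip: "i \<in> p" for i
    proof -
      obtain x K where i: "i = (x, K)" by (cases i)
      obtain u v where K: "K = {u..v}"
        using tagged_division_ofD(4)[OF p(1)] ip unfolding i cbox_interval by blast
      have "x \<in> K" "K \<subseteq> {c..d}"
        using tagged_division_ofD(2,3)[OF p(1)] ip i by auto
      moreover have "K \<subseteq> \<gamma> x"
        using p(2) ip i by (auto simp: fine_def)
      ultimately show "snd i = {l i..r i}" "fst i \<in> {l i..r i}" "l i \<le> r i" "c \<le> l i" "r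
          i \<le> d"
        "{l i..r i} \<subseteq> \<gamma> (fst i)"
        using K i by (auto simp: l_def r_def)
    qed
    have disj: "disjoint_family_on (\<lambda>i. {l i<..<r i}) p"
      unfolding disjoint_family_on_def
    proof (intro ballI impI)
      fix i j
      assume ij: "i \<in> p" "j \<in> p" "i \<noteq> j"
      then have "interior (snd i) \<inter> interior (snd j) = {}"
        using tagged_division_ofD(5)[OF p(1), of "fst i" "snd i" "fst j" "snd j"]
        by (simp add: prod_eq_iff)
      then show "{l i<..<r i} \<inter> {l j<..<r j} = {}"
        using piece(1)[OF ij(1)] piece(1)[OF ij(2)] by simp
    qed
    define J where "J = {i \<in> p. fst i \<in> N}"
    have J: "finite J" "J \<subseteq> p"
      using fin by (auto simp: J_def)
    have disjJ: "disjoint_family_on (\<lambda>i. {l i<..<r i}) J"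
      using disj J(2) by (meson disjoint_family_on_mono)
    have "(\<Sum>i\<in>J. r i - l i) = (\<Sum>i\<in>J. measure lebesgue {l i<..<r i})"
      using piece(3) J by (intro sum.cong) auto
    also have "\<dots> = measure lebesgue (\<Union>i\<in>J. {l i<..<r i})"
      using J disjJ piece(3) by (intro measure_finite_Union[symmetric]) (auto simp: subset_iff)
    also have "\<dots> \<le> measure lebesgue U"
    proof (rule measure_mono_fmeasurable)
      show "(\<Union>i\<in>J. {l i<..<r i}) \<subseteq> U"
      proof (intro UN_least)
        fix i assume "i \<in> J"
        then have "{l i..r i} \<subseteq> U"
          using piece(6)[of i] by (simp add: J_def \<gamma>_def)
        then show "{l i<..<r i} \<subseteq> U"
          using greaterThanLessThan_subseteq_atLeastAtMost_iff[of "l i" "r i" "l i" "r i"] by simp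
      qed
    qed (use U_meas in \<open>auto intro!: sets.countable_UN countable_finite J(1)\<close>)
    finally have sum: "(\<Sum>i\<in>J. r i - l i) < \<delta>"
      using U_small by simp
    have "\<forall>i\<in>J. c \<le> l i \<and> l i \<le> r i \<and> r i \<le> d"
      using piece(3-5) J(2) by blast
    with \<delta> J(1) disjJ sum have "(\<Sum>i\<in>J. \<bar>f (r i) - f (l i)\<bar>) < \<epsilon>"
      by blast
    moreover have "(\<Sum>i\<in>p - J. \<bar>f (r i) - f (l i)\<bar>) \<le> \<epsilon> * (d - c)"
    proof -
      \<comment> \<open>Straddle estimate: the tag lies between the two endpoints, so its distances
        to them add up to the length of the piece.\<close>
      have "\<bar>f (r i) - f (l i)\<bar> \<le> \<epsilon> * (r i - l i)" if "i \<in> p - J" for i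
      proof -
        let ?x = "fst i"
        have i: "i \<in> p" "?x \<notin> N"
          using that by (auto simp: J_def)
        note P = piece[OF i(1)]
        have x: "?x \<in> {c..d} - N"
          using i P by auto
        then have "{l i..r i} \<subseteq> ball ?x (e ?x)"
          using P(6) i by (simp add: \<gamma>_def)
        then have "\<bar>l i - ?x\<bar> < e ?x" "\<bar>r i - ?x\<bar> < e ?x"
          using P(3) by (auto simp: subset_iff dist_real_def abs_minus_commute)
        then have "\<bar>f (l i) - f ?x\<bar> \<le> \<epsilon> * \<bar>l i - ?x\<bar>" "\<bar>f (r
            i) - f ?x\<bar> \<le> \<epsilon> * \<bar>r i - ?x\<bar>"
          using P(3-5) by (auto intro!: e(2)[OF x])
        moreover have "\<bar>l i - ?x\<bar> = ?x - l i" "\<bar>r i - ?x\<bar> = r i - ?x"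
          using P(2) by simp_all
        ultimately show ?thesis
          by (simp add: algebra_simps)
      qed
      then have "(\<Sum>i\<in>p - J. \<bar>f (r i) - f (l i)\<bar>) \<le> (\<Sum>i\<in>p - J.
          \<epsilon> * (r i - l i))"
        by (rule sum_mono)
      also have "\<dots> \<le> (\<Sum>i\<in>p. \<epsilon> * (r i - l i))"
        using fin piece(3) \<open>\<epsilon> > 0\<close> by (intro sum_mono2) auto
      also have "\<dots> = \<epsilon> * (d - c)"
        using additive_tagged_division_1[OF \<open>c \<le> d\<close> p(1), of "\<lambda>x. x"]
        by (simp add: sum_distrib_left[symmetric] l_def r_def case_prod_beta)
      finally show ?thesis .
    qed
    moreover have "\<bar>f d - f c\<bar> \<le> (\<Sum>i\<in>p. \<bar>f (r i) - f (l i)\<bar>)"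
    proof -
      have "f d - f c = (\<Sum>i\<in>p. f (r i) - f (l i))"
        using additive_tagged_division_1[OF \<open>c \<le> d\<close> p(1), of f]
        by (simp add: l_def r_def case_prod_beta)
      then show ?thesis
        by (metis sum_abs)
    qed
    moreover have "(\<Sum>i\<in>p. \<bar>f (r i) - f (l i)\<bar>) =
        (\<Sum>i\<in>p - J. \<bar>f (r i) - f (l i)\<bar>) + (\<Sum>i\<in>J. \<bar>f (r i) - f (l
            i)\<bar>)"
      using fin J(2) by (rule sum.subset_diff[rotated])
    ultimately show ?thesis
      by linarith
  qed
  \<comment> \<open>The estimate reads \<epsilon> * \<open>K\<close>; taking \<epsilon> = \<eta> /
    \<open>K\<close> turns it into an arbitrary \<eta>.\<close>
  define K where "K = 1 + (d - c)"
  have "K > 0"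
    using \<open>c \<le> d\<close> by (simp add: K_def)
  have "\<bar>f d - f c\<bar> \<le> 0 + \<eta>" if "\<eta> > 0" for \<eta>
  proof -
    have "\<bar>f d - f c\<bar> \<le> \<eta> / K * K"
      using bound[of "\<eta> / K"] \<open>K > 0\<close> that by (simp only: K_def distrib_left
          mult_1_right) simp
    then show ?thesis
      using \<open>K > 0\<close> by simp
  qed
  then have "\<bar>f d - f c\<bar> \<le> 0"
    by (rule field_le_epsilon)
  then show ?thesis
    by simp
qed

lemma abs_continuous_on_constant_if_deriv_zero:
  assumes f: "abs_continuous_on c d f"
    and deriv: "AE t in lebesgue_on {c..d}. (f has_real_derivative 0) (at t)"
    and xy: "x \<in> {c..d}" "y \<in> {c..d}"
  shows "f x = f y"
proof -
  obtain N where N: "negligible N" "\<forall>t\<in>{c..d} - N. (f has_real_derivative 0) (at t)"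
    using deriv by (auto simp: AE_lebesgue_on_iff_negligible)
  have "f v = f u" if "c \<le> u" "u \<le> v" "v \<le> d" for u v
  proof (rule abs_continuous_on_ends_eq_if_deriv_zero[of u v f, OF _ _ N(1)])
    show "abs_continuous_on u v f"
      by (rule abs_continuous_on_subinterval[OF f]) (use that in auto)
  qed (use N(2) that in \<open>auto intro: has_field_derivative_at_within\<close>)
  then show ?thesis
    using xy by (metis atLeastAtMost_iff linear)
qed

section \<open>Indefinite integrals: absolute continuity and differentiation almost
  everywhere\<close>

lemma integral_sum_disjoint_le:
  fixes g :: "real \<Rightarrow> real"
  assumes g: "g integrable_on {c..d}" "\<And>x. x \<in> {c..d} \<Longrightarrow> g x \<ge> 0"
    and J: "finite J" "\<And>i. i \<in> J \<Longrightarrow> c \<le> l i \<and> l i \<le> r i \<and>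
        r i \<le> d"
    and disj: "disjoint_family_on (\<lambda>i. {l i<..<r i}) J"
  shows "(\<Sum>i\<in>J. integral {l i..r i} g) \<le> integral {c..d} g"
proof -
  \<comment> \<open>Open intervals, because adjacent closed ones share endpoints, where
    \<open>g\<close> would be counted twice. The integrals are the same.\<close>
  define G where "G i x = (if x \<in> {l i<..<r i} then g x else 0)" for i x
  have sub: "{l i<..<r i} \<inter> {c..d} = {l i<..<r i}" if "i \<in> J" for i
    using J(2)[OF that] by auto
  have "g integrable_on {l i<..<r i}" if "i \<in> J" for i
    using g(1) J(2)[OF that] by (intro integrable_on_subinterval[of g "{c..d}", THEN
        integrable_on_open_interval_real[THEN iffD2]]) auto
  then have int: "G i integrable_on {c..d}" if "i \<in> J" for i
    unfolding G_def using that by (subst integrable_restrict_Int) (simp add: sub)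
  have "integral {l i..r i} g = integral {c..d} (G i)" if "i \<in> J" for i
    unfolding G_def by (subst integral_restrict_Int) (simp add: sub[OF that]
        integral_open_interval_real)
  then have "(\<Sum>i\<in>J. integral {l i..r i} g) = (\<Sum>i\<in>J. integral {c..d} (G i))"
    by simp
  also have "\<dots> = integral {c..d} (\<lambda>x. \<Sum>i\<in>J. G i x)"
    using J(1) int by (rule integral_sum[symmetric])
  also have "\<dots> \<le> integral {c..d} g"
  proof (rule integral_le)
    show "(\<lambda>x. \<Sum>i\<in>J. G i x) integrable_on {c..d}"
      using J(1) int by (rule integrable_sum)
    show "(\<Sum>i\<in>J. G i x) \<le> g x" if x: "x \<in> {c..d}" for x
    proof -
      have "(\<Sum>i\<in>J. G i x) = (\<Sum>i\<in>J. indicator {l i<..<r i} x * g x)"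
        by (intro sum.cong) (auto simp: G_def)
      also have "\<dots> = indicator (\<Union>i\<in>J. {l i<..<r i}) x * g x"
        by (simp add: indicator_UN_disjoint[OF J(1) disj] sum_distrib_right)
      also have "\<dots> \<le> g x"
        using g(2)[OF x] by (simp add: indicator_def)
      finally show ?thesis .
    qed
  qed (use g in auto)
  finally show ?thesis .
qed

text \<open>Splits |f| into a part bounded by \<open>n\<close> and a remainder of small integral.
  The remainder vanishes at each point once \<open>n\<close> exceeds |f x|, and it is dominated by
  |f|.\<close>

lemma truncation_error_tendsto_zero:
  fixes f :: "real \<Rightarrow> real"
  assumes f: "f absolutely_integrable_on {c..d}"
  shows "(\<lambda>n::nat. integral {c..d} (\<lambda>x. \<bar>f x\<bar> - min \<bar>f x\<bar> n))
      \<longlonglongrightarrow> 0"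
    and "(\<lambda>x. \<bar>f x\<bar> - min \<bar>f x\<bar> (real n)) absolutely_integrable_on {c..d}"
proof -
  have abs: "(\<lambda>x. \<bar>f x\<bar>) absolutely_integrable_on {c..d}"
    using absolutely_integrable_norm[OF f] by (simp add: o_def)
  show trunc: "(\<lambda>x. \<bar>f x\<bar> - min \<bar>f x\<bar> (real n)) absolutely_integrable_on
      {c..d}" for n
    by (intro set_integral_diff(1) absolutely_integrable_min_1 abs
        absolutely_integrable_continuous_real) simp
  have "(\<lambda>n::nat. integral {c..d} (\<lambda>x. \<bar>f x\<bar> - min \<bar>f x\<bar> n))
      \<longlonglongrightarrow> integral {c..d} (\<lambda>_. 0)"
  proof (rule dominated_convergence(2)[where h = "\<lambda>x. \<bar>f x\<bar>"])
    show "(\<lambda>x. \<bar>f x\<bar> - min \<bar>f x\<bar> (real n)) integrable_on {c..d}" for n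
      using trunc by (rule set_lebesgue_integral_eq_integral(1))
    show "(\<lambda>x. \<bar>f x\<bar>) integrable_on {c..d}"
      using abs by (rule set_lebesgue_integral_eq_integral(1))
    show "(\<lambda>n::nat. \<bar>f x\<bar> - min \<bar>f x\<bar> n) \<longlonglongrightarrow> 0" for x
    proof (rule tendsto_eventually)
      show "\<forall>\<^sub>F n in sequentially. \<bar>f x\<bar> - min \<bar>f x\<bar> (real n) = 0"
        using eventually_ge_at_top[of "nat \<lceil>\<bar>f x\<bar>\<rceil>"] by eventually_elim linarith
    qed
  qed auto
  then show "(\<lambda>n::nat. integral {c..d} (\<lambda>x. \<bar>f x\<bar> - min \<bar>f x\<bar>
      n)) \<longlonglongrightarrow> 0"
    by simp
qed

text \<open>Over disjoint intervals the unbounded remainder of |f| contributes at most its whole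
  integral, less than half of \<epsilon>, and the truncated part at most \<open>M\<close> times the
  total length.\<close>

lemma abs_continuous_on_if_increments_integral:
  fixes f :: "real \<Rightarrow> real"
  assumes f: "f absolutely_integrable_on {c..d}"
    and F: "\<And>u v. c \<le> u \<Longrightarrow> u \<le> v \<Longrightarrow> v \<le> d
        \<Longrightarrow> F v - F u = integral {u..v} f"
  shows "abs_continuous_on c d F"
  unfolding abs_continuous_on_def
proof (intro allI impI)
  fix \<epsilon> :: real
  assume "\<epsilon> > 0"
  then have "\<forall>\<^sub>F n in sequentially. integral {c..d} (\<lambda>x. \<bar>f x\<bar> - min
      \<bar>f x\<bar> (real n)) < \<epsilon> / 2"
    using truncation_error_tendsto_zero(1)[OF f] by (intro order_tendstoD) auto
  then obtain m where m: "integral {c..d} (\<lambda>x. \<bar>f x\<bar> - min \<bar>f x\<bar> (real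
      m)) < \<epsilon> / 2"
    by (auto simp: eventually_sequentially)
  let ?g = "\<lambda>x. \<bar>f x\<bar> - min \<bar>f x\<bar> (real m)"
  have g: "?g absolutely_integrable_on {c..d}"
    using truncation_error_tendsto_zero(2)[OF f] .
  \<comment> \<open>The added 1 keeps the divisor positive when \<open>m = 0\<close>.\<close>
  define M where "M = real m + 1"
  have M: "M > 0" "real m \<le> M"
    by (auto simp: M_def)
  define \<delta> where "\<delta> = \<epsilon> / 2 / M"
  have \<delta>: "\<delta> > 0" "M * \<delta> = \<epsilon> / 2"
    using \<open>\<epsilon> > 0\<close> M by (auto simp: \<delta>_def)
  show "\<exists>\<delta>>0. \<forall>(n::nat) l r. (\<forall>i<n. c \<le> l i \<and> l i \<le> r i
      \<and> r i \<le> d) \<longrightarrow>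
        disjoint_family_on (\<lambda>i. {l i<..<r i}) {..<n} \<longrightarrow> (\<Sum>i<n. r i - l
            i) < \<delta> \<longrightarrow>
        (\<Sum>i<n. \<bar>F (r i) - F (l i)\<bar>) < \<epsilon>"
  proof (intro exI[of _ \<delta>] conjI allI impI)
    show "\<delta> > 0" by fact
    fix n :: nat and l r :: "nat \<Rightarrow> real"
    assume lr: "\<forall>i<n. c \<le> l i \<and> l i \<le> r i \<and> r i \<le> d"
      and disj: "disjoint_family_on (\<lambda>i. {l i<..<r i}) {..<n}"
      and sum: "(\<Sum>i<n. r i - l i) < \<delta>"
    have "\<bar>F (r i) - F (l i)\<bar> \<le> integral {l i..r i} ?g + M * (r i - l i)" if "i < n" for i
    proof -
      have sub: "{l i..r i} \<subseteq> {c..d}"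
        using lr that by auto
      have int: "f absolutely_integrable_on {l i..r i}" "?g absolutely_integrable_on {l i..r i}"
        using f g sub by (auto intro: absolutely_integrable_on_subinterval)
      have "\<bar>F (r i) - F (l i)\<bar> = norm (integral {l i..r i} f)"
        using F lr that by simp
      also have "\<dots> \<le> integral {l i..r i} (\<lambda>x. ?g x + M)"
        using int M by (intro integral_norm_bound_integral integrable_add
            set_lebesgue_integral_eq_integral(1)) auto
      also have "\<dots> = integral {l i..r i} ?g + M * (r i - l i)"
        using int lr that
        by (subst integral_add) (auto intro: set_lebesgue_integral_eq_integral(1))
      finally show ?thesis .
    qed
    then have "(\<Sum>i<n. \<bar>F (r i) - F (l i)\<bar>) \<le> (\<Sum>i<n. integral {l i..r i} ?g +
        M * (r i - l i))"
      by (intro sum_mono) auto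
    also have "\<dots> = (\<Sum>i<n. integral {l i..r i} ?g) + M * (\<Sum>i<n. r i - l i)"
      by (simp add: sum.distrib sum_distrib_left)
    also have "\<dots> < \<epsilon> / 2 + \<epsilon> / 2"
    proof (rule add_strict_mono)
      have "(\<Sum>i<n. integral {l i..r i} ?g) \<le> integral {c..d} ?g"
        using g disj lr by (intro integral_sum_disjoint_le set_lebesgue_integral_eq_integral(1)) auto
      then show "(\<Sum>i<n. integral {l i..r i} ?g) < \<epsilon> / 2"
        using m by linarith
      show "M * (\<Sum>i<n. r i - l i) < \<epsilon> / 2"
        unfolding \<delta>(2)[symmetric] using sum M by (intro mult_strict_left_mono) auto
    qed
    finally show "(\<Sum>i<n. \<bar>F (r i) - F (l i)\<bar>) < \<epsilon>"
      by simp
  qed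
qed

lemma primitive_diff:
  assumes f: "f integrable_on {- T..T}" and "- T \<le> u" "u \<le> v" "v \<le> T"
  shows "primitive f v - primitive f u = integral {u..v} f"
proof -
  have comb: "integral {x..y} f + integral {y..z} f = integral {x..z} f"
    if "- T \<le> x" "x \<le> y" "y \<le> z" "z \<le> T" for x y z
    using that by (intro Henstock_Kurzweil_Integration.integral_combine integrable_on_subinterval[OF
        f]) auto
  consider "0 \<le> u" | "v \<le> 0" | "u < 0" "0 < v"
    by linarith
  then show ?thesis
  proof cases
    case 1
    then show ?thesis
      using comb[of 0 u v] assms by (cases "u = 0"; cases "v = 0") (auto simp: primitive_def)
  next
    case 2
    then show ?thesis
      using comb[of u v 0] assms by (cases "u = 0"; cases "v = 0") (auto simp: primitive_def)
  next
    case 3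
    then show ?thesis
      using comb[of u 0 v] assms by (auto simp: primitive_def)
  qed
qed

lemma primitive_zero [simp]: "primitive f 0 = 0"
  by (simp add: primitive_def)

lemma abs_continuous_on_primitive:
  assumes "f absolutely_integrable_on {- T..T}"
  shows "abs_continuous_on (- T) T (primitive f)"
  using assms
  by (rule abs_continuous_on_if_increments_integral)
    (rule primitive_diff[OF set_lebesgue_integral_eq_integral(1)[OF assms]])

text \<open>Lebesgue differentiation on cubes having x as lower corner, hence one-sided on the line.
  Multiplying by \<open>h\<close> gives the form of the estimate that occurs in the definition of a
  derivative.\<close>

lemma integrable_right_derivative_negligible:
  fixes g :: "real \<Rightarrow> real"
  assumes "\<And>a b. g integrable_on {a..b}"
  obtains N where "negligible N"
    and "\<And>x e. x \<notin> N \<Longrightarrow> e > 0 \<Longrightarrow>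
      \<exists>d>0. \<forall>h. 0 < h \<and> h < d \<longrightarrow> \<bar>integral {x..x + h} g - h
          * g x\<bar> \<le> e * h"
proof -
  obtain N where N: "negligible N" "\<And>x e. x \<notin> N \<Longrightarrow> 0 < e \<Longrightarrow>
      \<exists>d>0. \<forall>h. 0 < h \<and> h < d \<longrightarrow> norm (integral (cbox x (x + h
          *\<^sub>R One)) g /\<^sub>R h ^ DIM(real) - g x) < e"
    by (rule integrable_ccontinuous_explicit[of g]) (use assms in auto)
  show ?thesis
  proof (rule that[OF N(1)])
    fix x e :: real
    assume "x \<notin> N" "e > 0"
    then obtain d where "d > 0"
      and d: "\<And>h. 0 < h \<Longrightarrow> h < d \<Longrightarrow> \<bar>integral {x..x + h} g /
          h - g x\<bar> < e"
      using N(2)[of x e] by (auto simp: divide_inverse_commute)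
    have "\<bar>integral {x..x + h} g - h * g x\<bar> \<le> e * h" if "0 < h" "h < d" for h
    proof -
      have "integral {x..x + h} g - h * g x = h * (integral {x..x + h} g / h - g x)"
        using that by (simp add: field_simps)
      then have "\<bar>integral {x..x + h} g - h * g x\<bar> = h * \<bar>integral {x..x + h} g / h -
          g x\<bar>"
        using that by (simp add: abs_mult)
      also have "\<dots> \<le> h * e"
        using d[OF that] that by (intro mult_left_mono) auto
      finally show ?thesis
        by (simp add: mult.commute)
    qed
    then show "\<exists>d>0. \<forall>h. 0 < h \<and> h < d \<longrightarrow> \<bar>integral {x..x +
        h} g - h * g x\<bar> \<le> e * h"
      using \<open>d > 0\<close> by blast
  qed
qed

lemma primitive_has_derivative_AE:
  assumes f: "f absolutely_integrable_on {- T..T}"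
  shows "AE t in lebesgue_on {- T..T}. (primitive f has_real_derivative f t) (at t)"
proof -
  \<comment> \<open>Extension by 0 gives a function integrable on every interval, as the
    differentiation result requires.\<close>
  define g where "g x = (if x \<in> {- T..T} then f x else 0)" for x
  have f_int: "f integrable_on {- T..T}"
    using f by (rule set_lebesgue_integral_eq_integral(1))
  then have "g integrable_on UNIV"
    unfolding g_def by (simp only: integrable_restrict_UNIV)
  then have g: "g integrable_on {a..b}" for a b
    by (rule integrable_on_subinterval) simp
  then have g': "(\<lambda>x. g (- x)) integrable_on {a..b}" for a b
    using Henstock_Kurzweil_Integration.integrable_reflect_real[where f = g and a = "- b" and b = "- a"]
    by simp
  obtain N where N: "negligible N" "\<And>x e. x \<notin> N \<Longrightarrow> e > 0 \<Longrightarrow>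
      \<exists>d>0. \<forall>h. 0 < h \<and> h < d \<longrightarrow> \<bar>integral {x..x + h} g - h
          * g x\<bar> \<le> e * h"
    using integrable_right_derivative_negligible[OF g] by blast
  \<comment> \<open>The missing left derivative at t is the right derivative of the reflected
    function at -t.\<close>
  obtain N' where N': "negligible N'" "\<And>x e. x \<notin> N' \<Longrightarrow> e > 0
      \<Longrightarrow>
      \<exists>d>0. \<forall>h. 0 < h \<and> h < d \<longrightarrow> \<bar>integral {x..x + h}
          (\<lambda>x. g (- x)) - h * g (- x)\<bar> \<le> e * h"
    using integrable_right_derivative_negligible[OF g'] by blast
  have "negligible (N \<union> uminus ` N' \<union> {- T, T})"
    using N(1) N'(1) by (simp add: negligible_uminus_image)
  moreover have "(primitive f has_real_derivative f t) (at t)"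
    if "t \<in> {- T..T} - (N \<union> uminus ` N' \<union> {- T, T})" for t
    unfolding has_field_derivative_def has_derivative_at_alt
  proof (intro conjI allI impI bounded_linear_mult_right)
    fix e :: real
    assume "e > 0"
    have t: "t \<notin> N" "- t \<notin> N'" "- T < t" "t < T"
      using that by (auto simp: image_iff)
    obtain d1 where d1: "d1 > 0" "\<And>h. 0 < h \<Longrightarrow> h < d1 \<Longrightarrow>
        \<bar>integral {t..t + h} g - h * g t\<bar> \<le> e * h"
      using N(2)[OF t(1) \<open>e > 0\<close>] by blast
    obtain d2 where d2: "d2 > 0"
      "\<And>h. 0 < h \<Longrightarrow> h < d2 \<Longrightarrow> \<bar>integral {- t..- t + h}
          (\<lambda>x. g (- x)) - h * g t\<bar> \<le> e * h"
      using N'(2)[OF t(2) \<open>e > 0\<close>] by auto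
    \<comment> \<open>The last two entries keep \<open>y\<close> inside \<open>{- T..T}\<close>,
      where \<open>f\<close> and \<open>g\<close> agree.\<close>
    define d where "d = Min {d1, d2, T - t, t + T}"
    have "d > 0"
      using d1 d2 t by (simp add: d_def)
    have fg: "integral {u..v} f = integral {u..v} g" if "- T \<le> u" "v \<le> T" for u v
      using that by (intro Henstock_Kurzweil_Integration.integral_cong) (auto simp: g_def)
    have gt: "g t = f t"
      using t by (simp add: g_def)
    have "norm (primitive f y - primitive f t - f t * (y - t)) \<le> e * norm (y - t)"
      if y: "norm (y - t) < d" for y
    proof (cases y t rule: linorder_cases)
      case less
      have yT: "- T \<le> y" "t - y < d2"
        using y less by (auto simp: d_def)
      have "primitive f t - primitive f y = integral {y..t} g"
        using primitive_diff[OF f_int, of y t] fg yT less t by simp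
      also have "\<dots> = integral {- t..- t + (t - y)} (\<lambda>x. g (- x))"
        using Henstock_Kurzweil_Integration.integral_reflect_real[of t y g] by simp
      finally show ?thesis
        using d2(2)[of "t - y"] less yT by (simp add: gt algebra_simps abs_minus_commute)
    next
      case equal
      then show ?thesis by simp
    next
      case greater
      have yT: "y \<le> T" "y - t < d1"
        using y greater by (auto simp: d_def)
      have "primitive f y - primitive f t = integral {t..y} g"
        using primitive_diff[OF f_int, of t y] fg yT greater t by simp
      then show ?thesis
        using d1(2)[of "y - t"] greater yT by (simp add: gt mult.commute)
    qed
    then show "\<exists>d>0. \<forall>y. norm (y - t) < d \<longrightarrow>
        norm (primitive f y - primitive f t - f t * (y - t)) \<le> e * norm (y - t)"
      using \<open>d > 0\<close> by blast
  qed
  ultimately show ?thesis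
    by (subst AE_lebesgue_on_iff_negligible) (simp, blast)
qed

lemma primitive_odd:
  assumes "AE t in lebesgue_on {- T..T}. f (- t) = f t" and "t \<in> {- T..T}"
  shows "primitive f (- t) = - primitive f t"
proof -
  obtain N where N: "negligible N" "\<forall>t\<in>{- T..T} - N. f (- t) = f t"
    using assms(1) by (auto simp: AE_lebesgue_on_iff_negligible)
  have "integral {- v..- u} f = integral {u..v} f" if "- T \<le> u" "v \<le> T" for u v
  proof -
    have "integral {- v..- u} f = integral {- v..- u} (\<lambda>x. f (- x))"
      by (rule integral_spike[OF N(1)]) (use N(2) that in auto)
    then show ?thesis
      using Henstock_Kurzweil_Integration.integral_reflect_real[of v u f] by simp
  qed
  from this[of 0 t] this[of t 0] show ?thesis
    using assms(2) by (cases "t \<ge> 0") (auto simp: primitive_def)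
qed

subsection \<open>Generalised cosine and sine, real-analytic functions\<close>

text \<open>\<open>gen_cos q x = cos (\<surd>q x)\<close> and \<open>gen_sin q x = sin (\<surd>q x)
    / \<surd>q\<close> for every real \<open>q\<close>; the three
  conditions of the theorem correspond to the sign of \<open>q = 1 - k\<^sup>2\<close>.\<close>

definition gen_cos :: "real \<Rightarrow> real \<Rightarrow> real" where
  "gen_cos q x = (if q > 0 then cos (sqrt q * x) else if q < 0 then cosh (sqrt (- q) * x) else 1)"

definition gen_sin :: "real \<Rightarrow> real \<Rightarrow> real" where
  "gen_sin q x =
     (if q > 0 then sin (sqrt q * x) / sqrt q else if q < 0 then sinh (sqrt (- q) * x) / sqrt (- q)
         else x)"

lemma gen_cos_0 [simp]: "gen_cos q 0 = 1" and gen_sin_0 [simp]: "gen_sin q 0 = 0"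
  by (simp_all add: gen_cos_def gen_sin_def)

lemma gen_cos_minus [simp]: "gen_cos q (- x) = gen_cos q x"
  and gen_sin_minus [simp]: "gen_sin q (- x) = - gen_sin q x"
  by (simp_all add: gen_cos_def gen_sin_def)

lemma gen_cos_add: "gen_cos q (x + y) = gen_cos q x * gen_cos q y - q * gen_sin q x * gen_sin q y"
  by (cases q "0::real" rule: linorder_cases)
    (simp_all add: gen_cos_def gen_sin_def distrib_left cos_add cosh_add)

lemma gen_sin_add: "gen_sin q (x + y) = gen_sin q x * gen_cos q y + gen_cos q x * gen_sin q y"
  by (cases q "0::real" rule: linorder_cases)
    (simp_all add: gen_cos_def gen_sin_def distrib_left sin_add sinh_add add_divide_distrib)

lemma gen_cos_diff: "gen_cos q (x - y) = gen_cos q x * gen_cos q y + q * gen_sin q x * gen_sin q y"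
  using gen_cos_add[of q x "- y"] by simp

lemma gen_sin_diff: "gen_sin q (x - y) = gen_sin q x * gen_cos q y - gen_cos q x * gen_sin q y"
  using gen_sin_add[of q x "- y"] by simp

lemma gen_cos_sin_pythagoras: "(gen_cos q x)\<^sup>2 + q * (gen_sin q x)\<^sup>2 = 1"
  using gen_cos_diff[of q x x] by (simp add: power2_eq_square mult.assoc)

lemma gen_cos_sin_neg:
  assumes "q < 0"
  obtains r where "r > 0" "q = - (r * r)"
    "gen_cos q = (\<lambda>x. cosh (r * x))" "gen_sin q = (\<lambda>x. sinh (r * x) / r)"
  by (rule that[of "sqrt (- q)"]) (use assms in \<open>auto simp: gen_cos_def gen_sin_def
      fun_eq_iff\<close>)

lemma gen_cos_sin_pos:
  assumes "q > 0"
  obtains r where "r > 0" "q = r * r"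
    "gen_cos q = (\<lambda>x. cos (r * x))" "gen_sin q = (\<lambda>x. sin (r * x) / r)"
  by (rule that[of "sqrt q"]) (use assms in \<open>auto simp: gen_cos_def gen_sin_def
      fun_eq_iff\<close>)

lemma gen_cos_sin_zero: "gen_cos 0 = (\<lambda>x. 1)" "gen_sin 0 = (\<lambda>x. x)"
  by (simp_all add: gen_cos_def gen_sin_def fun_eq_iff)

lemma has_real_derivative_gen_cos_sin:
  "(gen_cos q has_real_derivative - q * gen_sin q x) (at x)"
  "(gen_sin q has_real_derivative gen_cos q x) (at x)"
proof -
  have "(gen_cos q has_real_derivative - q * gen_sin q x) (at x) \<and>
        (gen_sin q has_real_derivative gen_cos q x) (at x)"
  proof (cases q "0::real" rule: linorder_cases)
    case less
    then obtain r where r: "r > 0" "q = - (r * r)"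
      "gen_cos q = (\<lambda>x. cosh (r * x))" "gen_sin q = (\<lambda>x. sinh (r * x) / r)"
      by (rule gen_cos_sin_neg)
    show ?thesis
      unfolding r(3,4) using r(1) by (auto intro!: derivative_eq_intros simp: r(2))
  next
    case equal
    show ?thesis
      unfolding equal gen_cos_sin_zero by (auto intro!: derivative_eq_intros)
  next
    case greater
    then obtain r where r: "r > 0" "q = r * r"
      "gen_cos q = (\<lambda>x. cos (r * x))" "gen_sin q = (\<lambda>x. sin (r * x) / r)"
      by (rule gen_cos_sin_pos)
    show ?thesis
      unfolding r(3,4) using r(1) by (auto intro!: derivative_eq_intros simp: r(2))
  qed
  then show "(gen_cos q has_real_derivative - q * gen_sin q x) (at x)"
    "(gen_sin q has_real_derivative gen_cos q x) (at x)"
    by blast+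
qed

lemma continuous_on_gen_cos: "continuous_on S (gen_cos q)"
  and continuous_on_gen_sin: "continuous_on S (gen_sin q)"
  by (rule DERIV_continuous_on, rule has_field_derivative_at_within,
      rule has_real_derivative_gen_cos_sin)+

lemma gen_cos_power_series: "\<exists>c. \<forall>x. (\<lambda>n. c n * x ^ n) sums gen_cos q x"
proof (cases q "0::real" rule: linorder_cases)
  case less
  then obtain r where r: "gen_cos q = (\<lambda>x. cosh (r * x))"
    by (rule gen_cos_sin_neg)
  show ?thesis
  proof (intro exI allI)
    fix x
    have "(\<lambda>n. if even n then (r * x) ^ n /\<^sub>R fact n else 0) =
        (\<lambda>n. (if even n then r ^ n / fact n else 0) * x ^ n)"
      by (auto simp: fun_eq_iff power_mult_distrib divide_inverse)
    then show "(\<lambda>n. (if even n then r ^ n / fact n else 0) * x ^ n) sums gen_cos q x"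
      using cosh_converges[of "r * x"] by (simp add: r)
  qed
next
  case equal
  show ?thesis
    unfolding equal gen_cos_sin_zero
    by (intro exI[of _ "\<lambda>n. if n = 0 then 1 else 0"] allI)
      (use powser_sums_if[of 0, where 'a = real] in simp)
next
  case greater
  then obtain r where r: "gen_cos q = (\<lambda>x. cos (r * x))"
    by (rule gen_cos_sin_pos)
  show ?thesis
    using cos_converges[of "r * x" for x]
    by (intro exI[of _ "\<lambda>n. cos_coeff n * r ^ n"]) (simp add: r power_mult_distrib mult.assoc)
qed

lemma gen_sin_power_series: "\<exists>c. \<forall>x. (\<lambda>n. c n * x ^ n) sums gen_sin q x"
proof (cases q "0::real" rule: linorder_cases)
  case less
  then obtain r where r: "gen_sin q = (\<lambda>x. sinh (r * x) / r)"
    by (rule gen_cos_sin_neg)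
  show ?thesis
  proof (intro exI allI)
    fix x
    have "(\<lambda>n. (if even n then 0 else (r * x) ^ n /\<^sub>R fact n) / r) =
        (\<lambda>n. (if even n then 0 else r ^ n / fact n / r) * x ^ n)"
      by (auto simp: fun_eq_iff power_mult_distrib divide_inverse)
    then show "(\<lambda>n. (if even n then 0 else r ^ n / fact n / r) * x ^ n) sums gen_sin q x"
      using sums_divide[OF sinh_converges[of "r * x"], where c = r] by (simp add: r)
  qed
next
  case equal
  show ?thesis
    unfolding equal gen_cos_sin_zero
    by (intro exI[of _ "\<lambda>n. if n = 1 then 1 else 0"] allI)
      (use powser_sums_if[of 1, where 'a = real] in simp)
next
  case greater
  then obtain r where r: "gen_sin q = (\<lambda>x. sin (r * x) / r)"
    by (rule gen_cos_sin_pos)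
  show ?thesis
    using sums_divide[OF sin_converges[of "r * x" for x], where c = r]
    by (intro exI[of _ "\<lambda>n. sin_coeff n * r ^ n / r"]) (simp add: r power_mult_distrib
        mult.assoc)
qed

lemma gen_sin_ne_0_if_C1:
  assumes "\<bar>k\<bar> < 1" "\<forall>n::nat. (1 - k\<^sup>2) * p\<^sup>2 \<noteq> (real n *
      pi)\<^sup>2"
  shows "gen_sin (1 - k\<^sup>2) p \<noteq> 0"
proof
  assume z: "gen_sin (1 - k\<^sup>2) p = 0"
  have q: "1 - k\<^sup>2 > 0"
    using assms(1) by (simp add: abs_square_less_1)
  then have "sin (sqrt (1 - k\<^sup>2) * p) = 0"
    using z by (simp add: gen_sin_def)
  then obtain i :: int where i: "sqrt (1 - k\<^sup>2) * p = of_int i * pi"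
    by (auto simp: sin_zero_iff_int2)
  then have "(1 - k\<^sup>2) * p\<^sup>2 = (of_int i * pi)\<^sup>2"
    using q by (metis less_imp_le power_mult_distrib real_sqrt_pow2)
  \<comment> \<open>The zeros of sin are indexed by integers, the hypothesis by naturals; squaring
    removes the sign.\<close>
  also have "\<dots> = (real (nat \<bar>i\<bar>) * pi)\<^sup>2"
    by (simp add: power_mult_distrib)
  finally show False
    using assms(2) by blast
qed

lemma gen_sin_ne_0_if_nonpos:
  assumes "q \<le> 0" "p \<noteq> 0"
  shows "gen_sin q p \<noteq> 0"
  using assms by (auto simp: gen_sin_def)

section \<open>Real-analytic functions of one variable and the identity theorem\<close>

definition real_analytic1 :: "(real \<Rightarrow> real) \<Rightarrow> bool" where
  "real_analytic1 f \<longleftrightarrow>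
     (\<forall>x0. \<exists>c. \<exists>\<rho>>0. \<forall>x. \<bar>x - x0\<bar> < \<rho>
         \<longrightarrow> (\<lambda>n. c n * (x - x0) ^ n) sums f x)"

lemma real_analytic1_diff:
  assumes "real_analytic1 f" "real_analytic1 g"
  shows "real_analytic1 (\<lambda>x. f x - g x)"
  unfolding real_analytic1_def
proof
  fix x0
  obtain c \<rho> where f: "\<rho> > 0" "\<And>x. \<bar>x - x0\<bar> < \<rho> \<Longrightarrow>
      (\<lambda>n. c n * (x - x0) ^ n) sums f x"
    using assms(1) unfolding real_analytic1_def by meson
  obtain c' \<rho>' where g: "\<rho>' > 0" "\<And>x. \<bar>x - x0\<bar> < \<rho>' \<Longrightarrow>
      (\<lambda>n. c' n * (x - x0) ^ n) sums g x"
    using assms(2) unfolding real_analytic1_def by meson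
  have "(\<lambda>n. (c n - c' n) * (x - x0) ^ n) sums (f x - g x)" if "\<bar>x - x0\<bar> < min
      \<rho> \<rho>'" for x
    using sums_diff[OF f(2) g(2), of x] that by (simp add: left_diff_distrib)
  then show "\<exists>c. \<exists>\<rho>>0. \<forall>x. \<bar>x - x0\<bar> < \<rho>
      \<longrightarrow> (\<lambda>n. c n * (x - x0) ^ n) sums (f x - g x)"
    using f(1) g(1) by (intro exI[of _ "\<lambda>n. c n - c' n"] exI[of _ "min \<rho> \<rho>'"]) auto
qed

lemma real_analytic1_cmult:
  assumes "real_analytic1 f"
  shows "real_analytic1 (\<lambda>x. C * f x)"
  unfolding real_analytic1_def
proof
  fix x0
  obtain c \<rho> where f: "\<rho> > 0" "\<And>x. \<bar>x - x0\<bar> < \<rho> \<Longrightarrow>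
      (\<lambda>n. c n * (x - x0) ^ n) sums f x"
    using assms(1) unfolding real_analytic1_def by meson
  have "(\<lambda>n. (C * c n) * (x - x0) ^ n) sums (C * f x)" if "\<bar>x - x0\<bar> < \<rho>" for x
    using sums_mult[OF f(2), of x C] that by (simp add: mult.assoc)
  then show "\<exists>c. \<exists>\<rho>>0. \<forall>x. \<bar>x - x0\<bar> < \<rho>
      \<longrightarrow> (\<lambda>n. c n * (x - x0) ^ n) sums (C * f x)"
    using f(1) by (intro exI[of _ "\<lambda>n. C * c n"] exI[of _ \<rho>]) auto
qed

text \<open>By the addition formulas such a combination is again one in the shifted variable
  \<open>x - x0\<close>, so the power series at 0 yield an expansion at every point.\<close>

lemma real_analytic1_gen_cos_sin:
  assumes f: "\<And>x. f x = \<alpha> * gen_cos q x + \<beta> * gen_sin q x"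
  shows "real_analytic1 f"
  unfolding real_analytic1_def
proof
  fix x0
  obtain c where c: "\<And>x. (\<lambda>n. c n * x ^ n) sums gen_cos q x"
    using gen_cos_power_series by blast
  obtain d where d: "\<And>x. (\<lambda>n. d n * x ^ n) sums gen_sin q x"
    using gen_sin_power_series by blast
  define \<alpha>' \<beta>' where "\<alpha>' = \<alpha> * gen_cos q x0 + \<beta> * gen_sin q x0"
    and "\<beta>' = - \<alpha> * q * gen_sin q x0 + \<beta> * gen_cos q x0"
  have "f x = \<alpha>' * gen_cos q (x - x0) + \<beta>' * gen_sin q (x - x0)" for x
  proof -
    have C: "gen_cos q x = gen_cos q x0 * gen_cos q (x - x0) - q * gen_sin q x0 * gen_sin q (x - x0)"
      and S: "gen_sin q x = gen_sin q x0 * gen_cos q (x - x0) + gen_cos q x0 * gen_sin q (x - x0)"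
      using gen_cos_add[of q x0 "x - x0"] gen_sin_add[of q x0 "x - x0"] by simp_all
    show ?thesis
      unfolding f C S \<alpha>'_def \<beta>'_def by (simp add: algebra_simps)
  qed
  then have "(\<lambda>n. (\<alpha>' * c n + \<beta>' * d n) * (x - x0) ^ n) sums f x" for x
    using sums_add[OF sums_mult[OF c] sums_mult[OF d], of \<alpha>' "x - x0" \<beta>' "x - x0"]
    by (simp add: distrib_right mult.assoc)
  then show "\<exists>c. \<exists>\<rho>>0. \<forall>x. \<bar>x - x0\<bar> < \<rho>
      \<longrightarrow> (\<lambda>n. c n * (x - x0) ^ n) sums f x"
    by (intro exI[of _ "\<lambda>n. \<alpha>' * c n + \<beta>' * d n"] exI[of _ 1]) auto
qed

lemma real_analytic1_isCont:
  assumes "real_analytic1 f"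
  shows "isCont f x0"
proof -
  obtain c \<rho> where f: "\<rho> > 0" "\<And>x. \<bar>x - x0\<bar> < \<rho> \<Longrightarrow>
      (\<lambda>n. c n * (x - x0) ^ n) sums f x"
    using assms(1) unfolding real_analytic1_def by meson
  have "((\<lambda>h. f (x0 + h)) \<longlongrightarrow> c 0) (at 0)"
    using f(2)[of "x0 + h" for h] by (intro powser_limit_0[OF f(1), of c]) auto
  moreover have "c 0 = f x0"
    using f(1) f(2)[of x0] by (auto simp: powser_sums_zero_iff)
  ultimately show ?thesis
    by (simp add: isCont_def LIM_offset_zero_iff)
qed

text \<open>The limit points of the zero set form a closed set. It is also open, since the power
  series at such a point vanishes identically. The line is connected, so one limit point
  suffices.\<close>

lemma real_analytic1_eq_0:
  assumes f: "real_analytic1 f" and lim: "a islimpt {x. f x = 0}"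
  shows "f y = 0"
proof -
  define Z where "Z = {x. x islimpt {x. f x = 0}}"
  have near: "\<exists>\<rho>>0. \<forall>x. \<bar>x - \<xi>\<bar> < \<rho> \<longrightarrow> f x =
      0" if "\<xi> \<in> Z" for \<xi>
  proof -
    have lim: "\<xi> islimpt {x. f x = 0}"
      using that by (simp add: Z_def)
    have "closed {x. f x = 0}"
      using continuous_closed_preimage_constant[of UNIV f 0] real_analytic1_isCont[OF f]
      by (auto simp: continuous_at_imp_continuous_on)
    then have z: "f \<xi> = 0"
      using lim by (auto simp: closed_limpt)
    obtain c \<rho> where c: "\<rho> > 0" "\<And>x. \<bar>x - \<xi>\<bar> < \<rho> \<Longrightarrow>
        (\<lambda>n. c n * (x - \<xi>) ^ n) sums f x"
      using f(1) unfolding real_analytic1_def by meson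
    \<comment> \<open>A nonzero coefficient of positive index would make the zero at \<xi>
      isolated.\<close>
    have c0: "c m = 0" if "m > 0" for m
    proof (rule ccontr)
      assume "c m \<noteq> 0"
      then obtain s where "s > 0" and s: "\<And>z. z \<in> cball \<xi> s - {\<xi>} \<Longrightarrow>
          f z \<noteq> 0"
        using powser_0_nonzero[of \<rho> \<xi> c f m] c z \<open>m > 0\<close> by (metis real_norm_def)
      from lim \<open>s > 0\<close> obtain z where "f z = 0" "z \<noteq> \<xi>" "dist z \<xi> < s"
        by (auto simp: islimpt_approachable)
      then show False
        using s[of z] by (auto simp: dist_commute)
    qed
    have "c 0 = 0"
      using c(1) c(2)[of \<xi>] z by (auto simp: powser_sums_zero_iff)
    with c0 have "c n = 0" for n
      by (cases "n = 0") auto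
    then have "f x = 0" if "\<bar>x - \<xi>\<bar> < \<rho>" for x
      using c(2)[OF that] by (simp add: sums_iff)
    then show ?thesis
      using c(1) by blast
  qed
  have "open Z"
    unfolding open_contains_ball
  proof
    fix \<xi>
    assume "\<xi> \<in> Z"
    then obtain \<rho> where \<rho>: "\<rho> > 0" "\<And>x. \<bar>x - \<xi>\<bar> < \<rho>
        \<Longrightarrow> f x = 0"
      using near by blast
    then have "ball \<xi> \<rho> \<subseteq> {x. f x = 0}"
      by (auto simp: dist_real_def abs_minus_commute)
    then have "ball \<xi> \<rho> \<subseteq> Z"
      unfolding Z_def by (metis (mono_tags, lifting) islimpt_subset mem_Collect_eq open_ball
          open_imp_islimpt subsetI)
    then show "\<exists>e>0. ball \<xi> e \<subseteq> Z"
      using \<rho>(1) by blast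
  qed
  moreover have "closed Z"
    unfolding Z_def by (rule closed_limpts)
  moreover have "a \<in> Z"
    using lim by (simp add: Z_def)
  ultimately have "Z = UNIV"
    using clopen[of Z] by auto
  then show ?thesis
    using near[of y] by (metis UNIV_I abs_zero diff_self)
qed

text \<open>In the expansion centred at \<open>(t, s0)\<close>, every term with m > 0 vanishes on
  the line through \<open>t\<close>, so the double series collapses to its row m = 0.\<close>

lemma real_analytic2_slice_right:
  assumes "real_analytic2 f"
  shows "real_analytic1 (\<lambda>s. f t s)"
  unfolding real_analytic1_def
proof
  fix s0
  obtain c \<rho> where \<rho>: "\<rho> > 0" and c: "\<forall>t' s. \<bar>t' - t\<bar> < \<rho>
      \<longrightarrow> \<bar>s - s0\<bar> < \<rho> \<longrightarrow>
      ((\<lambda>(m, n). c m n * (t' - t) ^ m * (s - s0) ^ n) has_sum f t' s) UNIV"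
    using assms[unfolded real_analytic2_def, THEN spec, THEN spec, of t s0] by (elim exE conjE)
  have "(\<lambda>n. c 0 n * (s - s0) ^ n) sums f t s" if "\<bar>s - s0\<bar> < \<rho>" for s
  proof -
    have "((\<lambda>(m, n). c m n * (t - t) ^ m * (s - s0) ^ n) has_sum f t s) UNIV"
      by (rule c[rule_format]) (use \<rho> that in simp_all)
    then have "((\<lambda>(m, n). c m n * (t - t) ^ m * (s - s0) ^ n) has_sum f t s) (range (Pair 0))"
      by (rule has_sum_cong_neutral[THEN iffD1, rotated -1]) (auto simp: image_iff)
    then have "((\<lambda>n. c 0 n * (s - s0) ^ n) has_sum f t s) UNIV"
      by (subst (asm) has_sum_reindex) (auto simp: inj_on_def o_def)
    then show ?thesis
      by (rule has_sum_imp_sums)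
  qed
  then show "\<exists>c. \<exists>\<rho>>0. \<forall>s. \<bar>s - s0\<bar> < \<rho>
      \<longrightarrow> (\<lambda>n. c n * (s - s0) ^ n) sums f t s"
    using \<rho> by (intro exI[of _ "\<lambda>n. c 0 n"] exI[of _ \<rho>]) simp
qed

lemma real_analytic2_slice_left:
  assumes "real_analytic2 f"
  shows "real_analytic1 (\<lambda>t. f t s)"
  unfolding real_analytic1_def
proof
  fix t0
  obtain c \<rho> where \<rho>: "\<rho> > 0" and c: "\<forall>t s'. \<bar>t - t0\<bar> < \<rho>
      \<longrightarrow> \<bar>s' - s\<bar> < \<rho> \<longrightarrow>
      ((\<lambda>(m, n). c m n * (t - t0) ^ m * (s' - s) ^ n) has_sum f t s') UNIV"
    using assms[unfolded real_analytic2_def, THEN spec, THEN spec, of t0 s] by (elim exE conjE)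
  have "(\<lambda>m. c m 0 * (t - t0) ^ m) sums f t s" if "\<bar>t - t0\<bar> < \<rho>" for t
  proof -
    have "((\<lambda>(m, n). c m n * (t - t0) ^ m * (s - s) ^ n) has_sum f t s) UNIV"
      by (rule c[rule_format]) (use \<rho> that in simp_all)
    then have "((\<lambda>(m, n). c m n * (t - t0) ^ m * (s - s) ^ n) has_sum f t s) (range
        (\<lambda>m. (m, 0)))"
      by (rule has_sum_cong_neutral[THEN iffD1, rotated -1]) (auto simp: image_iff)
    then have "((\<lambda>m. c m 0 * (t - t0) ^ m) has_sum f t s) UNIV"
      by (subst (asm) has_sum_reindex) (auto simp: inj_on_def o_def)
    then show ?thesis
      by (rule has_sum_imp_sums)
  qed
  then show "\<exists>c. \<exists>\<rho>>0. \<forall>t. \<bar>t - t0\<bar> < \<rho>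
      \<longrightarrow> (\<lambda>n. c n * (t - t0) ^ n) sums f t s"
    using \<rho> by (intro exI[of _ "\<lambda>m. c m 0"] exI[of _ \<rho>]) simp
qed

subsection \<open>The explicit kernel\<close>

text \<open>The solution of y'(t) + y(-t) + k y(t) = 0 with y(0) = 1.\<close>

definition green_factor :: "real \<Rightarrow> real \<Rightarrow> real" where
  "green_factor k x = gen_cos (1 - k\<^sup>2) x - (1 + k) * gen_sin (1 - k\<^sup>2) x"

text \<open>The difference y(-p) - y(p) for y = \<open>green_factor k\<close>: the coefficient of
  the unknown y(0) in the periodicity condition.\<close>

definition green_denom :: "real \<Rightarrow> real \<Rightarrow> real" where
  "green_denom k p = 2 * (1 + k) * gen_sin (1 - k\<^sup>2) p"

text \<open>The quotient, common to all regions up to the sign of \<open>p\<close>, carries the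
  value y(0) forced by periodicity: its second factor has \<open>p\<close> for s > 0 and
  \<open>- p\<close> for s < 0. The other terms form the kernel of the particular solution vanishing
  at 0. Regions 1 and 3 contain both signs of s; their expressions are written in the form found for
  s > 0.\<close>

definition green_expr1 :: "real \<Rightarrow> real \<Rightarrow> real \<Rightarrow> real
    \<Rightarrow> real" where
  "green_expr1 k p t s = green_factor k t * green_factor k (p - s) / green_denom k p
     + (gen_cos (1 - k\<^sup>2) (t - s) - k * gen_sin (1 - k\<^sup>2) (t - s))"

definition green_expr2 :: "real \<Rightarrow> real \<Rightarrow> real \<Rightarrow> real
    \<Rightarrow> real" where
  "green_expr2 k p t s = green_factor k t * green_factor k (p - s) / green_denom k p"

definition green_expr3 :: "real \<Rightarrow> real \<Rightarrow> real \<Rightarrow> real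
    \<Rightarrow> real" where
  "green_expr3 k p t s = green_factor k t * green_factor k (p - s) / green_denom k p
     - gen_sin (1 - k\<^sup>2) (t + s)"

definition green_expr4 :: "real \<Rightarrow> real \<Rightarrow> real \<Rightarrow> real
    \<Rightarrow> real" where
  "green_expr4 k p t s = green_factor k t * green_factor k (- p - s) / green_denom k p"

text \<open>Separates the variables, so that integration over x involves only the integrals of the
  generalised cosine and sine against the right-hand side.\<close>

lemma green_factor_diff:
  "green_factor k (p - x) =
    (gen_cos (1 - k\<^sup>2) p - (1 + k) * gen_sin (1 - k\<^sup>2) p) * gen_cos (1 - k\<^sup>2) x
    + ((1 - k\<^sup>2) * gen_sin (1 - k\<^sup>2) p + (1 + k) * gen_cos (1 - k\<^sup>2) p) * gen_sin
        (1 - k\<^sup>2) x"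
  unfolding green_factor_def gen_cos_diff gen_sin_diff by algebra

lemma green_factor_minus_diff:
  "green_factor k (- p - x) =
    (gen_cos (1 - k\<^sup>2) p + (1 + k) * gen_sin (1 - k\<^sup>2) p) * gen_cos (1 - k\<^sup>2) x
    + ((1 + k) * gen_cos (1 - k\<^sup>2) p - (1 - k\<^sup>2) * gen_sin (1 - k\<^sup>2) p) * gen_sin
        (1 - k\<^sup>2) x"
  unfolding green_factor_def gen_cos_diff gen_sin_diff gen_cos_minus gen_sin_minus by algebra

text \<open>Crossing s = 0 inside region 1 or 3 replaces \<open>p\<close> by \<open>- p\<close> in
  the quotient and exchanges the local term. The two changes cancel, so one expression serves the
  whole region. With C and S the generalised cosine and sine, both sides equal
  \<open>- green_denom k p\<close> times (C t - (1 + k) S t) (C s - (1 - k) S s).\<close>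

lemma green_factor_jump:
  "green_factor k t * (green_factor k (p - s) - green_factor k (- p - s)) =
    green_denom k p * (gen_sin (1 - k\<^sup>2) (t + s) - (gen_cos (1 - k\<^sup>2) (t - s) - k *
        gen_sin (1 - k\<^sup>2) (t - s)))"
  unfolding green_factor_def green_denom_def gen_cos_diff gen_sin_diff gen_sin_add gen_cos_minus
      gen_sin_minus
  by algebra

lemma green_expr1_alt:
  assumes "green_denom k p \<noteq> 0"
  shows "green_expr1 k p t s =
    green_factor k t * green_factor k (- p - s) / green_denom k p + gen_sin (1 - k\<^sup>2) (t + s)"
  using green_factor_jump[of k t p s] assms by (simp add: green_expr1_def field_simps)

lemma green_expr3_alt:
  assumes "green_denom k p \<noteq> 0"
  shows "green_expr3 k p t s = green_factor k t * green_factor k (- p - s) / green_denom k p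
     - (gen_cos (1 - k\<^sup>2) (t - s) - k * gen_sin (1 - k\<^sup>2) (t - s))"
  using green_factor_jump[of k t p s] assms by (simp add: green_expr3_def field_simps)

lemma green_denom_minus: "green_denom k (- p) = - green_denom k p"
  by (simp add: green_denom_def)

text \<open>Handles A(T) < 0: the kernel is built with the signed endpoint, the Green's function
  with its absolute value.\<close>

lemma green_expr_minus:
  assumes "green_denom k p \<noteq> 0"
  shows "green_expr1 k (- p) t s = - green_expr3 k p t s"
    and "green_expr2 k (- p) t s = - green_expr4 k p t s"
    and "green_expr3 k (- p) t s = - green_expr1 k p t s"
    and "green_expr4 k (- p) t s = - green_expr2 k p t s"
  unfolding green_expr1_alt[OF assms] green_expr3_alt[OF assms]
  by (simp_all add: green_expr1_def green_expr2_def green_expr3_def green_expr4_def green_denom_minus)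

text \<open>The oriented integral from 0 to t as a weight on the fixed interval. Primitives with
  different endpoints can then be added under one integral and compared with the kernel
  pointwise.\<close>

definition oriented_indicator :: "real \<Rightarrow> real \<Rightarrow> real" where
  "oriented_indicator t s = (if 0 < s \<and> s < t then 1 else if t < s \<and> s < 0 then - 1 else 0)"

lemma has_integral_oriented_indicator:
  assumes f: "f integrable_on {- T..T}" and t: "t \<in> {- T..T}"
  shows "((\<lambda>s. oriented_indicator t s * f s) has_integral primitive f t) {- T..T}"
proof (cases "t \<ge> 0")
  case True
  have "(f has_integral primitive f t) {0..t}"
    using integrable_integral[OF integrable_on_subinterval[OF f, of 0 t]] t True
    by (cases "t = 0") (auto simp: primitive_def)
  then have "((\<lambda>s. if s \<in> {0..t} then f s else 0) has_integral primitive f t) {- T..T}"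
    using t True by (subst has_integral_restrict) auto
  then show ?thesis
    by (rule has_integral_spike_finite[rotated 2, where S = "{0, t}"])
      (use True in \<open>auto simp: oriented_indicator_def\<close>)
next
  case False
  have "((\<lambda>s. - f s) has_integral primitive f t) {t..0}"
    using has_integral_neg[OF integrable_integral[OF integrable_on_subinterval[OF f, of t 0]]] t False
    by (auto simp: primitive_def)
  then have "((\<lambda>s. if s \<in> {t..0} then - f s else 0) has_integral primitive f t) {- T..T}"
    using t False by (subst has_integral_restrict) auto
  then show ?thesis
    by (rule has_integral_spike_finite[rotated 2, where S = "{0, t}"])
      (use False in \<open>auto simp: oriented_indicator_def\<close>)
qed

lemma primitive_linear:
  assumes "f integrable_on {- T..T}" "g integrable_on {- T..T}" "t \<in> {- T..T}"
  shows "primitive (\<lambda>s. \<alpha> * f s + \<beta> * g s) t = \<alpha> * primitive f t +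
      \<beta> * primitive g t"
proof -
  have sub: "f integrable_on {0..t}" "g integrable_on {0..t}" "f integrable_on {t..0}" "g
      integrable_on {t..0}"
    using assms by (auto intro: integrable_on_subinterval)
  have "integral S (\<lambda>s. \<alpha> * f s + \<beta> * g s) = \<alpha> * integral S f + \<beta>
      * integral S g"
    if "f integrable_on S" "g integrable_on S" for S
    using Henstock_Kurzweil_Integration.integral_add[OF integrable_cmul[OF that(1)]
        integrable_cmul[OF that(2)]]
    by simp
  from this[OF sub(1,2)] this[OF sub(3,4)] show ?thesis
    unfolding primitive_def by (simp add: algebra_simps)
qed

lemma absolutely_integrable_continuous_mult:
  fixes f g :: "real \<Rightarrow> real"
  assumes "continuous_on {c..d} g" "f absolutely_integrable_on {c..d}"
  shows "(\<lambda>x. g x * f x) absolutely_integrable_on {c..d}"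
  using assms
  by (intro absolutely_integrable_bounded_measurable_product_real)
    (auto intro!: continuous_imp_measurable_on_sets_lebesgue compact_imp_bounded
        compact_continuous_image)

section \<open>Variation of constants for the problem without the odd part of
  \<open>b\<close>\<close>

locale reduced_problem =
  fixes T k :: real and a H :: "real \<Rightarrow> real"
  assumes T: "T > 0"
    and a: "a absolutely_integrable_on {- T..T}" "AE t in lebesgue_on {- T..T}. a (- t) = a t"
    and H: "H absolutely_integrable_on {- T..T}"
begin

abbreviation "q \<equiv> 1 - k\<^sup>2"

abbreviation "CA t \<equiv> gen_cos q (primitive a t)"

abbreviation "SA t \<equiv> gen_sin q (primitive a t)"

abbreviation "Ic \<equiv> primitive (\<lambda>s. CA s * H s)"

abbreviation "Is \<equiv> primitive (\<lambda>s. SA s * H s)"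

lemma abs_continuous_CA: "abs_continuous_on (- T) T CA"
  and abs_continuous_SA: "abs_continuous_on (- T) T SA"
proof -
  show "abs_continuous_on (- T) T CA"
    by (rule abs_continuous_on_compose_C1[OF abs_continuous_on_primitive[OF a(1)]
        has_real_derivative_gen_cos_sin(1)])
      (intro continuous_intros continuous_on_gen_sin)
  show "abs_continuous_on (- T) T SA"
    by (rule abs_continuous_on_compose_C1[OF abs_continuous_on_primitive[OF a(1)]
        has_real_derivative_gen_cos_sin(2)])
      (rule continuous_on_gen_cos)
qed

lemma integrands: "(\<lambda>s. CA s * H s) absolutely_integrable_on {- T..T}"
  "(\<lambda>s. SA s * H s) absolutely_integrable_on {- T..T}"
  using abs_continuous_CA abs_continuous_SA H
  by (auto intro!: absolutely_integrable_continuous_mult abs_continuous_on_imp_continuous_on)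

text \<open>Variation of constants: \<open>center\<close> is \<open>sol 0\<close>, determined by
    \<open>sol (- T) = sol T\<close>; the integrals of
  \<open>gen_cos q (A t - A s) H(s)\<close> etc. are expanded by the addition formulas.\<close>

definition center :: real where
  "center = ((CA T - (1 + k) * SA T) * Ic T + (q * SA T + (1 + k) * CA T) * Is T
     - (CA T + (1 + k) * SA T) * Ic (- T) - ((1 + k) * CA T - q * SA T) * Is (- T))
     / green_denom k (primitive a T)"

definition sol :: "real \<Rightarrow> real" where
  "sol t = center * (CA t - (1 + k) * SA t) + (CA t - k * SA t) * Ic t + (q * SA t + k * CA t) * Is t
     - (SA t * Ic (- t) + CA t * Is (- t))"

lemma primitive_a_odd: "t \<in> {- T..T} \<Longrightarrow> primitive a (- t) = - primitive a t"
  using primitive_odd[OF a(2)] .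

lemma abs_continuous_sol: "abs_continuous_on (- T) T sol"
  unfolding sol_def
  by (intro abs_continuous_intros abs_continuous_CA abs_continuous_SA
      abs_continuous_on_reflect[OF abs_continuous_on_primitive]
      abs_continuous_on_primitive integrands)

lemma sol_boundary:
  assumes "green_denom k (primitive a T) \<noteq> 0"
  shows "sol (- T) = sol T"
proof -
  \<comment> \<open>In \<open>sol (- T) - sol T\<close> the coefficient of \<open>center\<close> is
    the denominator, and the remaining terms are minus the numerator of
    \<open>center\<close>.\<close>
  have "center * green_denom k (primitive a T) = (CA T - (1 + k) * SA T) * Ic T + (q * SA T + (1 +
      k) * CA T) * Is T
     - (CA T + (1 + k) * SA T) * Ic (- T) - ((1 + k) * CA T - q * SA T) * Is (- T)"
    using assms by (simp add: center_def)
  moreover have "primitive a (- T) = - primitive a T"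
    using primitive_a_odd T by simp
  ultimately show ?thesis
    unfolding sol_def green_denom_def by (simp add: algebra_simps)
qed

lemma sol_derivative:
  "AE t in lebesgue_on {- T..T}. (sol has_real_derivative H t - a t * (sol (- t) + k * sol t)) (at t)"
proof -
  note AE_a = primitive_has_derivative_AE[OF a(1)]
  note AE_c = primitive_has_derivative_AE[OF integrands(1)]
  note AE_s = primitive_has_derivative_AE[OF integrands(2)]
  show ?thesis
    using AE_a AE_c AE_s AE_lebesgue_on_reflect[OF AE_c] AE_lebesgue_on_reflect[OF AE_s]
      AE_lebesgue_on_interior[of "- T" T]
  proof eventually_elim
    case (elim t)
    have odd: "primitive a (- t) = - primitive a t"
      using primitive_a_odd elim(6) by simp
    have dC: "(CA has_real_derivative - q * SA t * a t) (at t)"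
      by (rule DERIV_chain2[OF has_real_derivative_gen_cos_sin(1) elim(1)])
    have dS: "(SA has_real_derivative CA t * a t) (at t)"
      by (rule DERIV_chain2[OF has_real_derivative_gen_cos_sin(2) elim(1)])
    have dIc: "((\<lambda>t. Ic (- t)) has_real_derivative CA (- t) * H (- t) * - 1) (at t)"
      by (rule DERIV_chain2[where g = uminus, OF elim(4)]) (auto intro!: derivative_eq_intros)
    have dIs: "((\<lambda>t. Is (- t)) has_real_derivative SA (- t) * H (- t) * - 1) (at t)"
      by (rule DERIV_chain2[where g = uminus, OF elim(5)]) (auto intro!: derivative_eq_intros)
    \<comment> \<open>The coefficient of \<open>H t\<close> in the derivative is
      \<open>(CA t)\<^sup>2 + q * (SA t)\<^sup>2\<close>; that of \<open>H (- t)\<close> cancels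
      because \<open>primitive a\<close> is odd.\<close>
    have pyth: "(CA t)\<^sup>2 + q * (SA t)\<^sup>2 = 1"
      by (rule gen_cos_sin_pythagoras)
    show ?case
      unfolding sol_def
      by (rule DERIV_cong,
          (rule dC dS elim(2,3) dIc dIs DERIV_add DERIV_diff DERIV_mult DERIV_const)+,
          use pyth in \<open>unfold odd gen_cos_minus gen_sin_minus minus_minus, algebra\<close>)
  qed
qed

text \<open>The kernel times \<open>H\<close> is a combination of four functions: \<open>G1\<close>
  on (0, T) and \<open>G2\<close> on (-T, 0) produce the term with \<open>center\<close>, while
  \<open>F1\<close> and \<open>F2\<close>, oriented from 0 to t and from 0 to -t, produce the
  particular solution.\<close>

lemma has_integral_sol:
  assumes t: "t \<in> {- T..T}" and N: "green_denom k (primitive a T) \<noteq> 0"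
  defines "p \<equiv> primitive a T"
  shows "((\<lambda>s. (if t > \<bar>s\<bar> then green_expr1 k p (primitive a t) (primitive a s)
      else if s > \<bar>t\<bar> then green_expr2 k p (primitive a t) (primitive a s)
      else if - t > \<bar>s\<bar> then green_expr3 k p (primitive a t) (primitive a s)
      else if - s > \<bar>t\<bar> then green_expr4 k p (primitive a t) (primitive a s)
      else 0) * H s) has_integral sol t) {- T..T}"
proof -
  let ?N = "green_denom k p" and ?D = "green_factor k (primitive a t)"
  let ?u = "\<lambda>s. CA s * H s" and ?v = "\<lambda>s. SA s * H s"
  have uv: "?u integrable_on {- T..T}" "?v integrable_on {- T..T}"
    using integrands by (auto intro: set_lebesgue_integral_eq_integral(1))
  have lin: "(\<lambda>s. \<alpha> * ?u s + \<beta> * ?v s) integrable_on {- T..T}" for \<alpha> \<beta>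
    using integrable_add[OF integrable_cmul[OF uv(1)] integrable_cmul[OF uv(2)]] by simp
  define G1 where "G1 s = ?D * green_factor k (p - primitive a s) / ?N * H s" for s
  define G2 where "G2 s = ?D * green_factor k (- p - primitive a s) / ?N * H s" for s
  define F1 where "F1 s = (gen_cos q (primitive a t - primitive a s) - k * gen_sin q (primitive a t
      - primitive a s)) * H s" for s
  define F2 where "F2 s = gen_sin q (primitive a t + primitive a s) * H s" for s
  have G1: "G1 = (\<lambda>s. ?D / ?N * (CA T - (1 + k) * SA T) * ?u s + ?D / ?N * (q * SA T + (1 +
      k) * CA T) * ?v s)"
    unfolding G1_def fun_eq_iff green_factor_diff p_def
    by (simp add: algebra_simps add_divide_distrib diff_divide_distrib)
  have G2: "G2 = (\<lambda>s. ?D / ?N * (CA T + (1 + k) * SA T) * ?u s + ?D / ?N * ((1 + k) * CA T -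
      q * SA T) * ?v s)"
    unfolding G2_def fun_eq_iff green_factor_minus_diff p_def
    by (simp add: algebra_simps add_divide_distrib diff_divide_distrib)
  have F1: "F1 = (\<lambda>s. (CA t - k * SA t) * ?u s + (q * SA t + k * CA t) * ?v s)"
    unfolding F1_def fun_eq_iff gen_cos_diff gen_sin_diff by (simp add: algebra_simps)
  have F2: "F2 = (\<lambda>s. SA t * ?u s + CA t * ?v s)"
    unfolding F2_def fun_eq_iff gen_sin_add by (simp add: algebra_simps)
  have int: "G1 integrable_on {- T..T}" "G2 integrable_on {- T..T}"
    "F1 integrable_on {- T..T}" "F2 integrable_on {- T..T}"
    unfolding G1 G2 F1 F2 by (rule lin)+
  have "((\<lambda>s. oriented_indicator T s * G1 s - oriented_indicator (- T) s * G2 s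
      + oriented_indicator t s * F1 s - oriented_indicator (- t) s * F2 s) has_integral
      (primitive G1 T - primitive G2 (- T) + primitive F1 t - primitive F2 (- t))) {- T..T}"
    using t T int by (intro has_integral_add has_integral_diff has_integral_oriented_indicator) auto
  also have "primitive G1 T - primitive G2 (- T) + primitive F1 t - primitive F2 (- t) = sol t"
  proof -
    have "primitive G1 T - primitive G2 (- T) = ?D * center"
    proof -
      have "primitive G1 T = ?D / ?N * (CA T - (1 + k) * SA T) * Ic T + ?D / ?N * (q * SA T + (1 +
          k) * CA T) * Is T"
        unfolding G1 by (rule primitive_linear[OF uv]) (use T in simp)
      moreover have "primitive G2 (- T) =
          ?D / ?N * (CA T + (1 + k) * SA T) * Ic (- T) + ?D / ?N * ((1 + k) * CA T - q * SA T) * Is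
              (- T)"
        unfolding G2 by (rule primitive_linear[OF uv]) (use T in simp)
      ultimately show ?thesis
        by (simp add: center_def p_def algebra_simps add_divide_distrib diff_divide_distrib)
    qed
    moreover have "primitive F1 t - primitive F2 (- t) =
        (CA t - k * SA t) * Ic t + (q * SA t + k * CA t) * Is t - (SA t * Ic (- t) + CA t * Is (- t))"
    proof -
      have "primitive F1 t = (CA t - k * SA t) * Ic t + (q * SA t + k * CA t) * Is t"
        unfolding F1 by (rule primitive_linear[OF uv t])
      moreover have "primitive F2 (- t) = SA t * Ic (- t) + CA t * Is (- t)"
        unfolding F2 by (rule primitive_linear[OF uv]) (use t in auto)
      ultimately show ?thesis
        by simp
    qed
    ultimately show ?thesis
      by (simp add: sol_def green_factor_def mult.commute)
  qed
  \<comment> \<open>The excluded points bound the regions or the supports of the weights.\<close>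
  finally show ?thesis
  proof (rule has_integral_spike_finite[rotated 2, where S = "{0, t, - t, T, - T}"])
    fix s
    assume s: "s \<in> {- T..T} - {0, t, - t, T, - T}"
    \<comment> \<open>For s < 0 the weights yield \<open>- p\<close>, so the expressions of regions
      1 and 3 are needed in their alternative form.\<close>
    note e = green_expr1_alt[OF N, folded p_def] green_expr3_alt[OF N, folded p_def]
    note defs = green_expr1_def green_expr2_def green_expr3_def green_expr4_def
    show "(if t > \<bar>s\<bar> then green_expr1 k p (primitive a t) (primitive a s)
      else if s > \<bar>t\<bar> then green_expr2 k p (primitive a t) (primitive a s)
      else if - t > \<bar>s\<bar> then green_expr3 k p (primitive a t) (primitive a s)
      else if - s > \<bar>t\<bar> then green_expr4 k p (primitive a t) (primitive a s)
      else 0) * H s =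
      oriented_indicator T s * G1 s - oriented_indicator (- T) s * G2 s
      + oriented_indicator t s * F1 s - oriented_indicator (- t) s * F2 s"
    proof (cases "s > 0")
      case True
      then have o: "oriented_indicator T s = 1" "oriented_indicator (- T) s = 0"
        "oriented_indicator t s = (if s < t then 1 else 0)"
        "oriented_indicator (- t) s = (if s < - t then 1 else 0)"
        using s by (auto simp: oriented_indicator_def)
      consider "s < t" | "s < - t" | "\<bar>t\<bar> < s"
        using s by fastforce
      then show ?thesis
        unfolding o using True
        by cases (auto simp: defs G1_def F1_def F2_def algebra_simps)
    next
      case False
      then have o: "oriented_indicator T s = 0" "oriented_indicator (- T) s = - 1"
        "oriented_indicator t s = (if t < s then - 1 else 0)"
        "oriented_indicator (- t) s = (if - t < s then - 1 else 0)"
        using s by (auto simp: oriented_indicator_def)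
      consider "t < s" | "- t < s" | "\<bar>t\<bar> < - s"
        using s by fastforce
      then show ?thesis
        unfolding o e using False s
        by cases (auto simp: defs(2,4) G2_def F1_def F2_def algebra_simps)
    qed
  qed simp
qed

end

subsection \<open>Reduction and uniqueness\<close>

text \<open>Two first integrals determine the solution: periodicity makes \<open>z T\<close> vanish,
  which makes both of them zero, and they can be solved for \<open>z\<close>.\<close>

lemma (in reduced_problem) homogeneous_solution_zero:
  assumes z: "abs_continuous_on (- T) T z"
    and ode: "AE t in lebesgue_on {- T..T}. (z has_real_derivative - (a t * (z (- t) + k * z t)))
        (at t)"
    and bdry: "z (- T) = z T" and N: "green_denom k (primitive a T) \<noteq> 0" and t: "t \<in> {-
        T..T}"
  shows "z t = 0"
proof -
  \<comment> \<open>The inverse of the fundamental matrix applied to (twice) the even and odd parts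
      of \<open>z\<close>.\<close>
  define w1 where "w1 t = CA t * (z t + z (- t)) - (1 - k) * SA t * (z t - z (- t))" for t
  define w2 where "w2 t = (1 + k) * SA t * (z t + z (- t)) + CA t * (z t - z (- t))" for t
  have ac: "abs_continuous_on (- T) T w1" "abs_continuous_on (- T) T w2"
    unfolding w1_def w2_def
    by (intro abs_continuous_intros abs_continuous_CA abs_continuous_SA z)+
  have "AE t in lebesgue_on {- T..T}. (w1 has_real_derivative 0) (at t) \<and> (w2
      has_real_derivative 0) (at t)"
    using primitive_has_derivative_AE[OF a(1)] ode AE_lebesgue_on_reflect[OF ode] a(2)
      AE_lebesgue_on_interior[of "- T" T]
  proof eventually_elim
    case (elim t)
    have dC: "(CA has_real_derivative - q * SA t * a t) (at t)"
      by (rule DERIV_chain2[OF has_real_derivative_gen_cos_sin(1) elim(1)])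
    have dS: "(SA has_real_derivative CA t * a t) (at t)"
      by (rule DERIV_chain2[OF has_real_derivative_gen_cos_sin(2) elim(1)])
    have dz: "((\<lambda>t. z (- t)) has_real_derivative - (a (- t) * (z (- (- t)) + k * z (- t))) *
        - 1) (at t)"
      by (rule DERIV_chain2[where g = uminus, OF elim(3)]) (auto intro!: derivative_eq_intros)
    have "(w1 has_real_derivative 0) (at t)"
      unfolding w1_def
      by (rule DERIV_cong, (rule dC dS elim(2) dz DERIV_add DERIV_diff DERIV_mult DERIV_const)+,
          unfold elim(4) minus_minus, algebra)
    moreover have "(w2 has_real_derivative 0) (at t)"
      unfolding w2_def
      by (rule DERIV_cong, (rule dC dS elim(2) dz DERIV_add DERIV_diff DERIV_mult DERIV_const)+,
          unfold elim(4) minus_minus, algebra)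
    ultimately show ?case ..
  qed
  then have const: "w1 t = w1 T" "w2 t = w2 0" "w2 T = w2 0" if "t \<in> {- T..T}" for t
    using that T by (auto intro!: abs_continuous_on_constant_if_deriv_zero[OF ac(1)]
        abs_continuous_on_constant_if_deriv_zero[OF ac(2)])
  have "w2 0 = 0"
    by (simp add: w2_def)
  \<comment> \<open>By periodicity the odd part of \<open>z\<close> drops out at \<open>T\<close>,
    leaving the even part with its factor \<open>(1 + k) * SA T\<close>.\<close>
  moreover have "w2 T = green_denom k (primitive a T) * z T"
    by (simp add: w2_def bdry green_denom_def)
  ultimately have "z T = 0"
    using const(3)[OF t] N by simp
  then have "w1 T = 0"
    by (simp add: w1_def bdry)
  with const[OF t] \<open>w2 0 = 0\<close> have "w1 t = 0" "w2 t = 0"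
    by simp_all
  moreover have "(CA t)\<^sup>2 + q * (SA t)\<^sup>2 = 1"
    by (rule gen_cos_sin_pythagoras)
  \<comment> \<open>The linear system for the even and odd parts has determinant
    \<open>(CA t)\<^sup>2 + q * (SA t)\<^sup>2 = 1\<close>.\<close>
  ultimately have "z t + z (- t) = 0" "z t - z (- t) = 0"
    unfolding w1_def w2_def by algebra+
  then show ?thesis
    by simp
qed

lemma even_part_minus: "even_part f (- t) = even_part f t"
  by (simp add: even_part_def)

lemma even_part_primitive_has_derivative_AE:
  assumes "b absolutely_integrable_on {- T..T}"
  shows "AE t in lebesgue_on {- T..T}. (even_part (primitive b) has_real_derivative (b t - b (- t))
      / 2) (at t)"
  using primitive_has_derivative_AE[OF assms] AE_lebesgue_on_reflect[OF
      primitive_has_derivative_AE[OF assms]]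
proof eventually_elim
  case (elim t)
  have "((\<lambda>t. primitive b (- t)) has_real_derivative b (- t) * - 1) (at t)"
    by (rule DERIV_chain2[where g = uminus, OF elim(2)]) (auto intro!: derivative_eq_intros)
  from DERIV_cdivide[OF DERIV_add[OF elim(1) this], of 2] show ?case
    by (simp add: even_part_def[abs_def])
qed

lemma abs_continuous_on_even_part_primitive:
  assumes "b absolutely_integrable_on {- T..T}"
  shows "abs_continuous_on (- T) T (even_part (primitive b))"
proof -
  have "abs_continuous_on (- T) T (\<lambda>t. (1/2) * (primitive b t + primitive b (- t)))"
    by (intro abs_continuous_intros abs_continuous_on_primitive assms
        abs_continuous_on_reflect[OF abs_continuous_on_primitive])
  then show ?thesis
    by (simp add: even_part_def[abs_def])
qed

lemma abs_continuous_on_exp: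
  assumes "abs_continuous_on c d f"
  shows "abs_continuous_on c d (\<lambda>t. exp (f t))"
  using assms by (rule abs_continuous_on_compose_C1[where \<phi>' = exp]) (auto intro:
      continuous_on_exp DERIV_exp)

lemma abs_continuous_on_cong:
  assumes "\<And>t. t \<in> {c..d} \<Longrightarrow> f t = g t" and g: "abs_continuous_on c d g"
  shows "abs_continuous_on c d f"
  using assms by (intro abs_continuous_on_lipschitz_pair[OF g g, of 1]) auto

text \<open>Needed because the integral formula and the function \<open>sol\<close> are known to
  agree only on the interval.\<close>

lemma periodic_solution_cong:
  assumes "T \<ge> 0" and eq: "\<And>t. t \<in> {- T..T} \<Longrightarrow> x t = y t" and y:
      "periodic_solution T a b h y"
  shows "periodic_solution T a b h x"
  unfolding periodic_solution_def
proof (intro conjI)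
  show "abs_continuous_on (- T) T x"
    using eq y unfolding periodic_solution_def by (intro abs_continuous_on_cong[of "- T" T x y]) auto
  show "x (- T) = x T"
    using eq y \<open>T \<ge> 0\<close> by (simp add: periodic_solution_def)
  have "AE t in lebesgue_on {- T..T}. \<exists>y'. (y has_real_derivative y') (at t within {- T..T})
      \<and>
      y' + a t * y (- t) + b t * y t = h t"
    using y by (simp add: periodic_solution_def)
  then show "AE t in lebesgue_on {- T..T}. \<exists>x'. (x has_real_derivative x') (at t within {-
      T..T}) \<and>
      x' + a t * x (- t) + b t * x t = h t"
    using AE_lebesgue_on_interior[of "- T" T]
  proof eventually_elim
    case (elim t)
    then obtain y' where "(y has_real_derivative y') (at t within {- T..T})"
      "y' + a t * y (- t) + b t * y t = h t" by blast
    moreover have "(x has_real_derivative y') (at t within {- T..T})"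
      using calculation(1) elim(2) eq unfolding has_field_derivative_def
      by (elim has_derivative_transform[rotated 2]) auto
    ultimately show ?case
      using eq elim(2) by (intro exI[of _ y']) auto
  qed
qed

text \<open>Removing the odd part of \<open>b\<close>: its primitive is the even part of the
    primitive of \<open>b\<close>,
  so that \<open>x\<close> solves the given problem iff \<open>y = exp (even_part B) * x\<close>
      solves the one with \<open>b\<close>
  replaced by its even part \<open>k * a\<close>.\<close>

locale reflection_problem =
  fixes T k :: real and a b h :: "real \<Rightarrow> real"
  assumes T_pos: "T > 0"
    and a_int: "a absolutely_integrable_on {- T..T}"
    and b_int: "b absolutely_integrable_on {- T..T}"
    and h_int: "h absolutely_integrable_on {- T..T}"
    and a_even: "AE t in lebesgue_on {- T..T}. a (- t) = a t"
    and b_even: "AE t in lebesgue_on {- T..T}. even_part b t = k * a t"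
    and denom: "green_denom k (primitive a T) \<noteq> 0"
begin

abbreviation "Be \<equiv> even_part (primitive b)"

lemmas Be_ac = abs_continuous_on_even_part_primitive[OF b_int]

sublocale reduced_problem T k a "\<lambda>s. exp (Be s) * h s"
proof
  show "(\<lambda>s. exp (Be s) * h s) absolutely_integrable_on {- T..T}"
    by (intro absolutely_integrable_continuous_mult h_int abs_continuous_on_imp_continuous_on
        abs_continuous_on_exp Be_ac)
qed (use T_pos a_int a_even in auto)

lemma periodic_solution_exp_sol: "periodic_solution T a b h (\<lambda>t. exp (- Be t) * sol t)"
  unfolding periodic_solution_def
proof (intro conjI)
  have "abs_continuous_on (- T) T (\<lambda>t. 0 - Be t)"
    by (intro abs_continuous_intros Be_ac)
  then show "abs_continuous_on (- T) T (\<lambda>t. exp (- Be t) * sol t)"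
    by (intro abs_continuous_on_mult abs_continuous_on_exp abs_continuous_sol) simp
  show "exp (- Be (- T)) * sol (- T) = exp (- Be T) * sol T"
    using sol_boundary[OF denom] by (simp add: even_part_minus)
  show "AE t in lebesgue_on {- T..T}. \<exists>x'. ((\<lambda>t. exp (- Be t) * sol t)
      has_real_derivative x') (at t within {- T..T}) \<and>
      x' + a t * (exp (- Be (- t)) * sol (- t)) + b t * (exp (- Be t) * sol t) = h t"
    using sol_derivative even_part_primitive_has_derivative_AE[OF b_int] b_even
  proof eventually_elim
    case (elim t)
    have d: "((\<lambda>t. exp (- Be t) * sol t) has_real_derivative
        exp (- Be t) * - ((b t - b (- t)) / 2) * sol t
        + (exp (Be t) * h t - a t * (sol (- t) + k * sol t)) * exp (- Be t)) (at t)"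
      by (intro DERIV_mult DERIV_fun_exp DERIV_minus elim)
    have b: "b (- t) = 2 * k * a t - b t"
      using elim(3) by (simp add: even_part_def field_simps)
    have e: "exp (- Be t) * exp (Be t) = 1"
      by (simp flip: exp_add)
    show ?case
    proof (intro exI conjI)
      show "((\<lambda>t. exp (- Be t) * sol t) has_real_derivative
        exp (- Be t) * - ((b t - b (- t)) / 2) * sol t
        + (exp (Be t) * h t - a t * (sol (- t) + k * sol t)) * exp (- Be t)) (at t within {- T..T})"
        using d by (rule has_field_derivative_at_within)
      show "exp (- Be t) * - ((b t - b (- t)) / 2) * sol t
        + (exp (Be t) * h t - a t * (sol (- t) + k * sol t)) * exp (- Be t)
        + a t * (exp (- Be (- t)) * sol (- t)) + b t * (exp (- Be t) * sol t) = h t"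
      proof -
        have "exp (- Be t) * - ((b t - b (- t)) / 2) * sol t
          + (exp (Be t) * h t - a t * (sol (- t) + k * sol t)) * exp (- Be t)
          + a t * (exp (- Be (- t)) * sol (- t)) + b t * (exp (- Be t) * sol t)
          = (exp (- Be t) * exp (Be t)) * h t"
          unfolding b even_part_minus by (simp add: field_simps)
        then show ?thesis
          unfolding e by simp
      qed
    qed
  qed
qed

lemma periodic_solution_imp_reduced:
  assumes x: "periodic_solution T a b h x"
  shows "AE t in lebesgue_on {- T..T}. ((\<lambda>t. exp (Be t) * x t) has_real_derivative
    exp (Be t) * h t - a t * (exp (Be (- t)) * x (- t) + k * (exp (Be t) * x t))) (at t)"
proof -
  have "AE t in lebesgue_on {- T..T}. \<exists>x'. (x has_real_derivative x') (at t within {- T..T})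
      \<and>
      x' + a t * x (- t) + b t * x t = h t"
    using x by (simp add: periodic_solution_def)
  then show ?thesis
    using even_part_primitive_has_derivative_AE[OF b_int] b_even AE_lebesgue_on_interior[of "- T" T]
  proof eventually_elim
    case (elim t)
    have "at t within {- T..T} = at t"
      using elim(4) by (intro at_within_interior) simp
    with elim(1) obtain x' where x': "(x has_real_derivative x') (at t)"
      "x' + a t * x (- t) + b t * x t = h t"
      by metis
    have d: "((\<lambda>t. exp (Be t) * x t) has_real_derivative
        exp (Be t) * ((b t - b (- t)) / 2) * x t + x' * exp (Be t)) (at t)"
      by (intro DERIV_mult DERIV_fun_exp elim x')
    have b: "b (- t) = 2 * k * a t - b t"
      using elim(3) by (simp add: even_part_def field_simps)
    show ?case
      unfolding even_part_minus
      by (rule DERIV_cong[OF d]) (simp add: b algebra_simps diff_divide_distrib flip: x'(2))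
  qed
qed

lemma periodic_solution_unique:
  assumes x: "periodic_solution T a b h x" and y: "periodic_solution T a b h y" and t: "t \<in> {-
      T..T}"
  shows "x t = y t"
proof -
  define z where "z t = exp (Be t) * x t - exp (Be t) * y t" for t
  have ac: "abs_continuous_on (- T) T x" "abs_continuous_on (- T) T y"
    using x y by (auto simp: periodic_solution_def)
  have "z t = 0"
  proof (rule homogeneous_solution_zero[OF _ _ _ denom t])
    show "abs_continuous_on (- T) T z"
      unfolding z_def by (intro abs_continuous_intros abs_continuous_on_exp Be_ac ac)
    show "z (- T) = z T"
      using x y by (simp add: z_def even_part_minus periodic_solution_def)
    show "AE t in lebesgue_on {- T..T}. (z has_real_derivative - (a t * (z (- t) + k * z t))) (at t)"
      using periodic_solution_imp_reduced[OF x] periodic_solution_imp_reduced[OF y]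
    proof eventually_elim
      case (elim t)
      show ?case
        unfolding z_def by (rule DERIV_cong[OF DERIV_diff[OF elim]]) (simp add: algebra_simps)
    qed
  qed
  then show ?thesis
    by (simp add: z_def)
qed

lemma integral_green1:
  assumes t: "t \<in> {- T..T}"
  defines "p \<equiv> primitive a T"
  shows "integral {- T..T} (\<lambda>s. green1 (primitive a) (primitive b)
    (green_expr1 k p) (green_expr2 k p) (green_expr3 k p) (green_expr4 k p) t s * h s) = exp (- Be
        t) * sol t"
proof -
  have "((\<lambda>s. exp (- Be t) * ((if t > \<bar>s\<bar> then green_expr1 k p (primitive a t)
      (primitive a s)
      else if s > \<bar>t\<bar> then green_expr2 k p (primitive a t) (primitive a s)
      else if - t > \<bar>s\<bar> then green_expr3 k p (primitive a t) (primitive a s)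
      else if - s > \<bar>t\<bar> then green_expr4 k p (primitive a t) (primitive a s)
      else 0) * (exp (Be s) * h s))) has_integral exp (- Be t) * sol t) {- T..T}"
    by (rule has_integral_mult_right) (rule has_integral_sol[OF t denom, folded p_def])
  then show ?thesis
    by (intro integral_unique, elim has_integral_eq[rotated])
      (simp add: green1_def exp_diff exp_minus divide_inverse mult_ac)
qed

text \<open>Applied twice: to the given problem, and with \<open>a = 1\<close>, \<open>b = k\<close>
  to obtain a reference kernel for the constant-coefficient problem.\<close>

theorem unique_periodic_solution_green1:
  defines "p \<equiv> primitive a T"
  shows "unique_periodic_solution T a b h (\<lambda>t. integral {- T..T} (\<lambda>s. green1
      (primitive a) (primitive b)
    (green_expr1 k p) (green_expr2 k p) (green_expr3 k p) (green_expr4 k p) t s * h s))"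
proof -
  have sol: "periodic_solution T a b h (\<lambda>t. integral {- T..T} (\<lambda>s. green1 (primitive
      a) (primitive b)
    (green_expr1 k p) (green_expr2 k p) (green_expr3 k p) (green_expr4 k p) t s * h s))"
    unfolding p_def
    by (rule periodic_solution_cong[OF _ integral_green1 periodic_solution_exp_sol]) (use T_pos in simp)
  show ?thesis
    unfolding unique_periodic_solution_def
    by (intro conjI sol allI impI ballI) (rule periodic_solution_unique[OF _ sol])
qed

end

subsection \<open>Identification of the analytic expressions\<close>

lemma real_analytic1_add:
  assumes "real_analytic1 f" "real_analytic1 g"
  shows "real_analytic1 (\<lambda>x. f x + g x)"
  using real_analytic1_diff[OF assms(1) real_analytic1_cmult[OF assms(2), of "- 1"]] by simp

lemma real_analytic1_green_factor:
  "real_analytic1 (green_factor k)" "real_analytic1 (\<lambda>x. green_factor k (p - x))"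
  by (rule real_analytic1_gen_cos_sin[of _ 1 "1 - k\<^sup>2" "- (1 + k)"],
      simp add: green_factor_def algebra_simps)
    (rule real_analytic1_gen_cos_sin, rule green_factor_diff)

lemma real_analytic1_gen_cos_sin_shift:
  "real_analytic1 (\<lambda>x. gen_sin q (x + w))" "real_analytic1 (\<lambda>x. gen_sin q (w + x))"
  "real_analytic1 (\<lambda>x. gen_cos q (x - w))" "real_analytic1 (\<lambda>x. gen_cos q (w - x))"
  "real_analytic1 (\<lambda>x. gen_sin q (x - w))" "real_analytic1 (\<lambda>x. gen_sin q (w - x))"
proof -
  show "real_analytic1 (\<lambda>x. gen_sin q (x + w))"
    by (rule real_analytic1_gen_cos_sin[of _ "gen_sin q w" q "gen_cos q w"]) (simp add: gen_sin_add)
  show "real_analytic1 (\<lambda>x. gen_sin q (w + x))"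
    by (rule real_analytic1_gen_cos_sin[of _ "gen_sin q w" q "gen_cos q w"]) (simp add: gen_sin_add)
  show "real_analytic1 (\<lambda>x. gen_cos q (x - w))"
    by (rule real_analytic1_gen_cos_sin[of _ "gen_cos q w" q "q * gen_sin q w"]) (simp add:
        gen_cos_diff)
  show "real_analytic1 (\<lambda>x. gen_cos q (w - x))"
    by (rule real_analytic1_gen_cos_sin[of _ "gen_cos q w" q "q * gen_sin q w"]) (simp add:
        gen_cos_diff)
  show "real_analytic1 (\<lambda>x. gen_sin q (x - w))"
    by (rule real_analytic1_gen_cos_sin[of _ "- gen_sin q w" q "gen_cos q w"]) (simp add: gen_sin_diff)
  show "real_analytic1 (\<lambda>x. gen_sin q (w - x))"
    by (rule real_analytic1_gen_cos_sin[of _ "gen_sin q w" q "- gen_cos q w"]) (simp add: gen_sin_diff)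
qed

lemmas real_analytic1_intros = real_analytic1_add real_analytic1_diff real_analytic1_cmult
  real_analytic1_gen_cos_sin_shift

lemma real_analytic1_factor_left:
  "real_analytic1 (\<lambda>t. green_factor k t * c / d)"
  using real_analytic1_cmult[OF real_analytic1_green_factor(1), of "c / d" k] by (simp add:
      mult.commute)

lemma real_analytic1_factor_right:
  "real_analytic1 (\<lambda>s. c * green_factor k (p - s) / d)"
  using real_analytic1_cmult[OF real_analytic1_green_factor(2), of "c / d" k p] by simp

lemma real_analytic1_green_expr:
  "real_analytic1 (\<lambda>t. green_expr1 k p t s)" "real_analytic1 (green_expr1 k p t)"
  "real_analytic1 (\<lambda>t. green_expr2 k p t s)" "real_analytic1 (green_expr2 k p t)"
  "real_analytic1 (\<lambda>t. green_expr3 k p t s)" "real_analytic1 (green_expr3 k p t)"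
  "real_analytic1 (\<lambda>t. green_expr4 k p t s)" "real_analytic1 (green_expr4 k p t)"
  unfolding green_expr1_def[abs_def] green_expr2_def[abs_def] green_expr3_def[abs_def]
      green_expr4_def[abs_def]
  by (intro real_analytic1_intros real_analytic1_factor_left real_analytic1_factor_right)+

section \<open>The constant-coefficient problem and comparison of its Green's functions\<close>

lemma primitive_const: "primitive (\<lambda>_. c) = (\<lambda>t. c * t)"
proof
  show "primitive (\<lambda>_. c) t = c * t" for t
    by (cases "t \<ge> 0") (auto simp: primitive_def)
qed

definition constant_green :: "real \<Rightarrow> real \<Rightarrow> real \<Rightarrow> real
    \<Rightarrow> real" where
  "constant_green k \<tau> = green1 (\<lambda>t. t) (\<lambda>t. k * t)
     (green_expr1 k \<tau>) (green_expr2 k \<tau>) (green_expr3 k \<tau>) (green_expr4 k \<tau>)"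

lemma constant_green_eq:
  "constant_green k \<tau> t s =
     (if t > \<bar>s\<bar> then green_expr1 k \<tau> t s
      else if s > \<bar>t\<bar> then green_expr2 k \<tau> t s
      else if - t > \<bar>s\<bar> then green_expr3 k \<tau> t s
      else if - s > \<bar>t\<bar> then green_expr4 k \<tau> t s else 0)"
  by (simp add: constant_green_def green1_def even_part_def)

lemma constant_green_solution:
  assumes "\<tau> > 0" "green_denom k \<tau> \<noteq> 0" "f absolutely_integrable_on {- \<tau>..\<tau>}"
  shows "periodic_solution \<tau> (\<lambda>_. 1) (\<lambda>_. k) f (\<lambda>t. integral {-
      \<tau>..\<tau>} (\<lambda>s. constant_green k \<tau> t s * f s))"
proof -
  interpret reflection_problem \<tau> k "\<lambda>_. 1" "\<lambda>_. k" f
    by standard (use assms in \<open>auto simp: even_part_def primitive_const intro!: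
        absolutely_integrable_continuous_real\<close>)
  show ?thesis
    using unique_periodic_solution_green1
    by (simp add: unique_periodic_solution_def constant_green_def primitive_const)
qed

lemma constant_green_regions:
  assumes "green_denom k p \<noteq> 0" "p \<noteq> 0"
  shows "sgn p * t > \<bar>s\<bar> \<Longrightarrow> constant_green k \<bar>p\<bar> t s = sgn p *
      green_expr1 k p t s"
    and "sgn p * s > \<bar>t\<bar> \<Longrightarrow> constant_green k \<bar>p\<bar> t s = sgn p *
        green_expr2 k p t s"
    and "- (sgn p * t) > \<bar>s\<bar> \<Longrightarrow> constant_green k \<bar>p\<bar> t s = sgn p
        * green_expr3 k p t s"
    and "- (sgn p * s) > \<bar>t\<bar> \<Longrightarrow> constant_green k \<bar>p\<bar> t s = sgn p
        * green_expr4 k p t s"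
  using assms(2)
  by (cases "p > 0"; force simp: constant_green_eq green_expr_minus[OF assms(1)])+

text \<open>Uniqueness of the solution makes the integrals of both kernels against any f equal at
  this very t. Choosing f as the difference of the two slices gives a vanishing integral of a
  square, and continuity upgrades equality almost everywhere to equality everywhere.\<close>

lemma green_slice_eq:
  assumes G: "is_green_function k \<tau> G" and \<tau>: "\<tau> > 0" "green_denom k \<tau> \<noteq> 0"
    and t: "t \<in> {- \<tau>..\<tau>}" and I: "\<alpha> < \<beta>" "{\<alpha>..\<beta>} \<subseteq>
        {- \<tau>..\<tau>}" and "\<sigma> \<noteq> 0"
    and eq: "\<And>s. s \<in> {\<alpha>..\<beta>} \<Longrightarrow> G t s = \<sigma> * \<kappa> s
        \<and> constant_green k \<tau> t s = \<sigma> * e s"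
    and cont: "continuous_on {\<alpha>..\<beta>} \<kappa>" "continuous_on {\<alpha>..\<beta>} e" and
        s: "s \<in> {\<alpha>..\<beta>}"
  shows "\<kappa> s = e s"
proof -
  define d where "d s = \<kappa> s - e s" for s
  \<comment> \<open>Cutting off outside one segment of a region avoids any knowledge of
    \<open>G\<close> elsewhere.\<close>
  define f where "f s = (if s \<in> {\<alpha>..\<beta>} then d s else 0)" for s
  have d: "continuous_on {\<alpha>..\<beta>} d"
    unfolding d_def by (intro continuous_intros cont)
  have inter: "{\<alpha>..\<beta>} \<inter> {- \<tau>..\<tau>} = {\<alpha>..\<beta>}"
    using I(2) by blast
  have "d absolutely_integrable_on {\<alpha>..\<beta>}"
    using d by (rule absolutely_integrable_continuous_real)
  then have "f absolutely_integrable_on UNIV"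
    unfolding f_def by (simp only: absolutely_integrable_restrict_UNIV)
  then have f: "f absolutely_integrable_on {- \<tau>..\<tau>}"
    by (rule absolutely_integrable_on_subinterval) simp
  have restr: "integral {- \<tau>..\<tau>} (\<lambda>s. K s * f s) = integral {\<alpha>..\<beta>}
      (\<lambda>s. K s * d s)" for K
  proof -
    have "(\<lambda>s. K s * f s) = (\<lambda>s. if s \<in> {\<alpha>..\<beta>} then K s * d s else 0)"
      by (auto simp: f_def)
    then show ?thesis
      by (simp only: integral_restrict_Int inter)
  qed
  have "integral {\<alpha>..\<beta>} (\<lambda>s. G t s * d s) = integral {\<alpha>..\<beta>}
      (\<lambda>s. constant_green k \<tau> t s * d s)"
    using G f t constant_green_solution[OF \<tau> f]
    unfolding is_green_function_def unique_periodic_solution_def restr[symmetric] by fastforce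
  moreover have "integral {\<alpha>..\<beta>} (\<lambda>s. G t s * d s) = \<sigma> * integral
      {\<alpha>..\<beta>} (\<lambda>s. \<kappa> s * d s)"
    unfolding integral_mult_right[symmetric]
    by (intro Henstock_Kurzweil_Integration.integral_cong) (simp add: eq mult.assoc)
  moreover have "integral {\<alpha>..\<beta>} (\<lambda>s. constant_green k \<tau> t s * d s) =
      \<sigma> * integral {\<alpha>..\<beta>} (\<lambda>s. e s * d s)"
    unfolding integral_mult_right[symmetric]
    by (intro Henstock_Kurzweil_Integration.integral_cong) (simp add: eq mult.assoc)
  ultimately have "integral {\<alpha>..\<beta>} (\<lambda>s. \<kappa> s * d s) = integral
      {\<alpha>..\<beta>} (\<lambda>s. e s * d s)"
    using \<open>\<sigma> \<noteq> 0\<close> by simp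
  then have "integral {\<alpha>..\<beta>} (\<lambda>s. \<kappa> s * d s - e s * d s) = 0"
    using cont d
    by (subst Henstock_Kurzweil_Integration.integral_diff)
      (auto intro!: integrable_continuous_real continuous_intros)
  then have "integral {\<alpha>..\<beta>} (\<lambda>s. (d s)\<^sup>2) = 0"
    by (simp add: d_def power2_eq_square algebra_simps)
  moreover have "continuous_on {\<alpha>..\<beta>} (\<lambda>s. (d s)\<^sup>2)"
    by (intro continuous_intros d)
  ultimately have "(d s)\<^sup>2 = 0"
    using integral_eq_0_iff[of \<alpha> \<beta> "\<lambda>s. (d s)\<^sup>2"] I(1) s by simp
  then show ?thesis
    by (simp add: d_def)
qed

text \<open>The identity theorem is used once in each variable: agreement on a segment in s extends
  to all s for each t = \<epsilon> * r, and these t accumulate at 0, which extends it to all t. The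
  sign \<epsilon> selects a ray that meets the region.\<close>

lemma green_expression_eq:
  assumes G: "is_green_function k \<tau> G" and \<tau>: "\<tau> > 0" "green_denom k \<tau> \<noteq>
      0" and "\<sigma> \<noteq> 0"
    and \<kappa>: "real_analytic2 \<kappa>" and e: "\<And>t. real_analytic1 (e t)" "\<And>s.
        real_analytic1 (\<lambda>t. e t s)"
    and \<epsilon>: "\<bar>\<epsilon>\<bar> = 1"
    and region: "\<And>r. 0 < r \<Longrightarrow> r < \<tau> \<Longrightarrow> \<exists>\<alpha>
        \<beta>. \<alpha> < \<beta> \<and> {\<alpha>..\<beta>} \<subseteq> {- \<tau>..\<tau>} \<and>
        (\<forall>s\<in>{\<alpha>..\<beta>}. G (\<epsilon> * r) s = \<sigma> * \<kappa> (\<epsilon>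
            * r) s \<and> constant_green k \<tau> (\<epsilon> * r) s = \<sigma> * e (\<epsilon> * r) s)"
  shows "\<kappa> = e"
proof -
  have slice: "\<kappa> (\<epsilon> * r) s - e (\<epsilon> * r) s = 0" if r: "0 < r" "r < \<tau>"
      for r s
  proof -
    obtain \<alpha> \<beta> where I: "\<alpha> < \<beta>" "{\<alpha>..\<beta>} \<subseteq> {-
        \<tau>..\<tau>}"
      and eq: "\<And>s. s \<in> {\<alpha>..\<beta>} \<Longrightarrow> G (\<epsilon> * r) s =
          \<sigma> * \<kappa> (\<epsilon> * r) s \<and> constant_green k \<tau> (\<epsilon> * r) s =
          \<sigma> * e (\<epsilon> * r) s"
      using region[OF r] by blast
    have ra: "real_analytic1 (\<lambda>s. \<kappa> (\<epsilon> * r) s)" "real_analytic1 (\<lambda>s.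
        e (\<epsilon> * r) s)"
      using real_analytic2_slice_right[OF \<kappa>] e(1) by auto
    have "\<epsilon> * r \<in> {- \<tau>..\<tau>}"
      using r \<epsilon> by (auto simp: abs_if split: if_splits)
    then have "\<kappa> (\<epsilon> * r) s = e (\<epsilon> * r) s" if "s \<in> {\<alpha>..\<beta>}"
        for s
      using real_analytic1_isCont[OF ra(1)] real_analytic1_isCont[OF ra(2)] that
      by (intro green_slice_eq[OF G \<tau> _ I \<open>\<sigma> \<noteq> 0\<close> eq])
        (auto intro!: continuous_at_imp_continuous_on)
    then have "{\<alpha><..<\<beta>} \<subseteq> {s. \<kappa> (\<epsilon> * r) s - e (\<epsilon> *
        r) s = 0}"
      by auto
    moreover have "(\<alpha> + \<beta>) / 2 islimpt {\<alpha><..<\<beta>}"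
      using I(1) by (intro open_imp_islimpt) auto
    ultimately show ?thesis
      using real_analytic1_eq_0[OF real_analytic1_diff[OF ra]] islimpt_subset by blast
  qed
  have "\<kappa> t s - e t s = 0" for t s
  proof (rule real_analytic1_eq_0[of "\<lambda>t. \<kappa> t s - e t s" 0])
    show "real_analytic1 (\<lambda>t. \<kappa> t s - e t s)"
      by (intro real_analytic1_diff real_analytic2_slice_left \<kappa> e)
    show "0 islimpt {t. \<kappa> t s - e t s = 0}"
      unfolding islimpt_approachable
    proof (intro allI impI)
      fix \<eta> :: real
      assume "\<eta> > 0"
      \<comment> \<open>Small enough for both bounds: \<epsilon> * \<open>r\<close> lies in the
        interval where slices agree and within \<eta> of 0.\<close>
      define r where "r = min \<eta> \<tau> / 2"
      have r: "0 < r" "r < \<tau>" "r < \<eta>"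
        using \<open>\<eta> > 0\<close> \<tau>(1) by (auto simp: r_def min_def)
      then show "\<exists>t\<in>{t. \<kappa> t s - e t s = 0}. t \<noteq> 0 \<and> dist t 0 < \<eta>"
        using slice[of r s] \<epsilon> by (intro bexI[of _ "\<epsilon> * r"]) (auto simp: abs_mult)
    qed
  qed
  then show ?thesis
    by (simp add: fun_eq_iff)
qed


lemma green_expressions_eq:
  assumes G: "is_green_function k \<bar>p\<bar> G" and \<kappa>: "green_expressions p G k1 k2 k3 k4"
    and p: "green_denom k p \<noteq> 0"
  shows "k1 = green_expr1 k p" "k2 = green_expr2 k p" "k3 = green_expr3 k p" "k4 = green_expr4 k p"
proof -
  let ?\<sigma> = "sgn p" and ?\<tau> = "\<bar>p\<bar>"
  have "p \<noteq> 0"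
    using p by (auto simp: green_denom_def)
  then have \<sigma>: "?\<sigma> = 1 \<or> ?\<sigma> = - 1" and \<tau>: "?\<tau> > 0"
    by (auto simp: sgn_if)
  have N: "green_denom k ?\<tau> \<noteq> 0"
    using p green_denom_minus[of k p] by (simp add: abs_if)
  note regions = constant_green_regions[OF p \<open>p \<noteq> 0\<close>]
  have analytic: "real_analytic2 k1" "real_analytic2 k2" "real_analytic2 k3" "real_analytic2 k4"
    using \<kappa> by (simp_all add: green_expressions_def)
  have G_regions: "?\<sigma> * t > \<bar>s\<bar> \<Longrightarrow> G t s = ?\<sigma> * k1 t s"
      "?\<sigma> * s > \<bar>t\<bar> \<Longrightarrow> G t s = ?\<sigma> * k2 t s"
    "- (?\<sigma> * t) > \<bar>s\<bar> \<Longrightarrow> G t s = ?\<sigma> * k3 t s" "- (?\<sigma> *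
        s) > \<bar>t\<bar> \<Longrightarrow> G t s = ?\<sigma> * k4 t s"
    if "t \<in> {- ?\<tau>..?\<tau>}" "s \<in> {- ?\<tau>..?\<tau>}" for t s
    using \<kappa> that unfolding green_expressions_def by blast+
  have \<sigma>0: "?\<sigma> \<noteq> 0"
    using \<sigma> by linarith
  have \<sigma>r: "?\<sigma> * (?\<sigma> * r) = r" "?\<sigma> * (- ?\<sigma> * r) = - r" for r
    using \<sigma> by auto
  have \<sigma>t: "?\<sigma> * r \<in> {- ?\<tau>..?\<tau>}" "- ?\<sigma> * r \<in> {-
      ?\<tau>..?\<tau>}" if "0 < r" "r < ?\<tau>" for r
    using \<sigma> that by auto
  show "k1 = green_expr1 k p"
  proof (rule green_expression_eq[OF G \<tau> N \<sigma>0 analytic(1)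
      real_analytic1_green_expr(2,1), of ?\<sigma>])
    fix r assume r: "0 < r" "r < ?\<tau>"
    \<comment> \<open>Half of \<open>r\<close> keeps the segment strictly inside the
      diagonals.\<close>
    have "G (?\<sigma> * r) s = ?\<sigma> * k1 (?\<sigma> * r) s \<and>
        constant_green k ?\<tau> (?\<sigma> * r) s = ?\<sigma> * green_expr1 k p (?\<sigma> * r) s"
            if "s \<in> {- r / 2..r / 2}" for s
      using that r by (intro conjI G_regions(1) regions(1) \<sigma>t) (auto simp: \<sigma>r)
    then show "\<exists>\<alpha> \<beta>. \<alpha> < \<beta> \<and> {\<alpha>..\<beta>} \<subseteq>
        {- ?\<tau>..?\<tau>} \<and> (\<forall>s\<in>{\<alpha>..\<beta>}. G (?\<sigma> * r) s =
        ?\<sigma> * k1 (?\<sigma> * r) s \<and>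
        constant_green k ?\<tau> (?\<sigma> * r) s = ?\<sigma> * green_expr1 k p (?\<sigma> * r) s)"
      using r by (intro exI[of _ "- r / 2"] exI[of _ "r / 2"]) auto
  qed (use \<sigma> in auto)
  show "k3 = green_expr3 k p"
  proof (rule green_expression_eq[OF G \<tau> N \<sigma>0 analytic(3)
      real_analytic1_green_expr(6,5), of "- ?\<sigma>"])
    fix r assume r: "0 < r" "r < ?\<tau>"
    have "G (- ?\<sigma> * r) s = ?\<sigma> * k3 (- ?\<sigma> * r) s \<and>
        constant_green k ?\<tau> (- ?\<sigma> * r) s = ?\<sigma> * green_expr3 k p (- ?\<sigma> * r)
            s" if "s \<in> {- r / 2..r / 2}" for s
      using that r by (intro conjI G_regions(3) regions(3) \<sigma>t) (auto simp: \<sigma>r simp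
          del: mult_minus_left)
    then show "\<exists>\<alpha> \<beta>. \<alpha> < \<beta> \<and> {\<alpha>..\<beta>} \<subseteq>
        {- ?\<tau>..?\<tau>} \<and> (\<forall>s\<in>{\<alpha>..\<beta>}. G (- ?\<sigma> * r) s =
        ?\<sigma> * k3 (- ?\<sigma> * r) s \<and>
        constant_green k ?\<tau> (- ?\<sigma> * r) s = ?\<sigma> * green_expr3 k p (- ?\<sigma> * r) s)"
      using r by (intro exI[of _ "- r / 2"] exI[of _ "r / 2"]) auto
  qed (use \<sigma> in auto)
  \<comment> \<open>Segments for regions 2 and 4: beyond the diagonal at t = \<open>r\<close>, up to
    the end of the interval on the side given by the sign.\<close>
  have far: "\<exists>\<alpha> \<beta>. \<alpha> < \<beta> \<and> {\<alpha>..\<beta>} \<subseteq> {-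
      ?\<tau>..?\<tau>} \<and> (\<forall>s\<in>{\<alpha>..\<beta>}. \<epsilon> * s > \<bar>r\<bar>)"
    if r: "0 < r" "r < ?\<tau>" and \<epsilon>: "\<epsilon> = 1 \<or> \<epsilon> = - 1" for r \<epsilon>
    using \<epsilon>
  proof
    assume "\<epsilon> = 1"
    then show ?thesis
      using r by (intro exI[of _ "(r + ?\<tau>) / 2"] exI[of _ ?\<tau>]) auto
  next
    assume "\<epsilon> = - 1"
    then show ?thesis
      using r by (intro exI[of _ "- ?\<tau>"] exI[of _ "- (r + ?\<tau>) / 2"]) auto
  qed
  show "k2 = green_expr2 k p"
  proof (rule green_expression_eq[OF G \<tau> N \<sigma>0 analytic(2)
      real_analytic1_green_expr(4,3), of 1])
    fix r assume r: "0 < r" "r < ?\<tau>"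
    obtain \<alpha> \<beta> where I: "\<alpha> < \<beta>" "{\<alpha>..\<beta>} \<subseteq> {-
        ?\<tau>..?\<tau>}" "\<forall>s\<in>{\<alpha>..\<beta>}. ?\<sigma> * s > \<bar>r\<bar>"
      using far[OF r \<sigma>] by blast
    then have "G r s = ?\<sigma> * k2 r s \<and> constant_green k ?\<tau> r s = ?\<sigma> *
        green_expr2 k p r s"
      if "s \<in> {\<alpha>..\<beta>}" for s
      using that r by (intro conjI G_regions(2) regions(2)) auto
    with I(1,2) show "\<exists>\<alpha> \<beta>. \<alpha> < \<beta> \<and> {\<alpha>..\<beta>}
        \<subseteq> {- ?\<tau>..?\<tau>} \<and> (\<forall>s\<in>{\<alpha>..\<beta>}. G (1 * r) s =
        ?\<sigma> * k2 (1 * r) s \<and>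
        constant_green k ?\<tau> (1 * r) s = ?\<sigma> * green_expr2 k p (1 * r) s)"
      unfolding mult_1_left by blast
  qed simp
  show "k4 = green_expr4 k p"
  proof (rule green_expression_eq[OF G \<tau> N \<sigma>0 analytic(4)
      real_analytic1_green_expr(8,7), of 1])
    fix r assume r: "0 < r" "r < ?\<tau>"
    have "- ?\<sigma> = 1 \<or> - ?\<sigma> = - 1"
      using \<sigma> by auto
    then obtain \<alpha> \<beta> where I: "\<alpha> < \<beta>" "{\<alpha>..\<beta>} \<subseteq> {-
        ?\<tau>..?\<tau>}" "\<forall>s\<in>{\<alpha>..\<beta>}. - ?\<sigma> * s > \<bar>r\<bar>"
      using far[OF r] by blast
    then have "G r s = ?\<sigma> * k4 r s \<and> constant_green k ?\<tau> r s = ?\<sigma> *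
        green_expr4 k p r s"
      if "s \<in> {\<alpha>..\<beta>}" for s
      using that r by (intro conjI G_regions(4) regions(4)) auto
    with I(1,2) show "\<exists>\<alpha> \<beta>. \<alpha> < \<beta> \<and> {\<alpha>..\<beta>}
        \<subseteq> {- ?\<tau>..?\<tau>} \<and> (\<forall>s\<in>{\<alpha>..\<beta>}. G (1 * r) s =
        ?\<sigma> * k4 (1 * r) s \<and>
        constant_green k ?\<tau> (1 * r) s = ?\<sigma> * green_expr4 k p (1 * r) s)"
      unfolding mult_1_left by blast
  qed simp
qed

text \<open>Each condition excludes k = -1. The generalised sine at A(T) is nonzero because its
  zeros are excluded in the trigonometric case, and 0 is its only zero in the hyperbolic and linear
  cases.\<close>

lemma conditions_imp:
  assumes "cond_C1 T a b k \<or> cond_C2 T a b k \<or> cond_C3 T a b k"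
  shows "AE t in lebesgue_on {- T..T}. even_part b t = k * a t"
    and "green_denom k (primitive a T) \<noteq> 0"
proof -
  show "AE t in lebesgue_on {- T..T}. even_part b t = k * a t"
    using assms by (auto simp: cond_C1_def cond_C2_def cond_C3_def)
  from assms show "green_denom k (primitive a T) \<noteq> 0"
  proof (elim disjE)
    assume "cond_C1 T a b k"
    then have "gen_sin (1 - k\<^sup>2) (primitive a T) \<noteq> 0" "1 + k \<noteq> 0"
      using gen_sin_ne_0_if_C1[of k "primitive a T"] by (auto simp: cond_C1_def)
    then show ?thesis
      by (simp add: green_denom_def)
  next
    assume C: "cond_C2 T a b k"
    \<comment> \<open>The instance n = 0 yields A(T) \<noteq> 0.\<close>
    then have "\<bar>k\<bar> > 1" and "(1 - k\<^sup>2) * (primitive a T)\<^sup>2 \<noteq> (real 0 *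
        pi)\<^sup>2"
      unfolding cond_C2_def by blast+
    then have "1 - k\<^sup>2 \<le> 0" "primitive a T \<noteq> 0" "1 + k \<noteq> 0"
      using one_le_power[of "\<bar>k\<bar>" 2] by auto
    then show ?thesis
      using gen_sin_ne_0_if_nonpos by (simp add: green_denom_def)
  next
    assume "cond_C3 T a b k"
    then show ?thesis
      using gen_sin_ne_0_if_nonpos[of 0 "primitive a T"] by (simp add: cond_C3_def green_denom_def)
  qed
qed

theorem mainTheorem6:
  fixes T k :: real
    and a b h A B :: "real \<Rightarrow> real"
    and G2 k1 k2 k3 k4 G1 :: "real \<Rightarrow> real \<Rightarrow> real"
  assumes "T > 0"
    and "a absolutely_integrable_on {- T..T}"
    and "b absolutely_integrable_on {- T..T}"
    and "h absolutely_integrable_on {- T..T}"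
    and "AE t in lebesgue_on {- T..T}. a (- t) = a t"
    and "A = primitive a"
    and "B = primitive b"
    and "cond_C1 T a b k \<or> cond_C2 T a b k \<or> cond_C3 T a b k"
    and "is_green_function k \<bar>A T\<bar> G2"
    and "green_expressions (A T) G2 k1 k2 k3 k4"
    and "G1 = green1 A B k1 k2 k3 k4"
    and "\<forall>t\<in>{- T..T}. (\<lambda>s. G1 t s * h s) absolutely_integrable_on {- T..T}"
  shows "unique_periodic_solution T a b h (\<lambda>t. integral {- T..T} (\<lambda>s. G1 t s * h s))"
proof -
  note cond = conditions_imp[OF assms(8)]
  interpret reflection_problem T k a b h
    by standard (use assms(1-5) cond in auto)
  \<comment> \<open>Equality as functions on the plane, since \<open>(A t, A s)\<close> may lie
    outside the square and in a region different from that of \<open>(t, s)\<close>.\<close>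
  have "k1 = green_expr1 k (A T)" "k2 = green_expr2 k (A T)"
    "k3 = green_expr3 k (A T)" "k4 = green_expr4 k (A T)"
    using green_expressions_eq[OF assms(9,10)] cond(2) assms(6) by auto
  then show ?thesis
    using unique_periodic_solution_green1 by (simp only: assms(6,7,11))
qed

end
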